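(* Let $h$ be a Legendre-type function as in the context, $(1/\beta)$-strongly convex on $\mathcal{D}$ with respect to $\|\cdot\|_2$, with associated Legendre-type loss $S$ and decoding $d$. Let $(x_i,y_i)_{i=1}^n$ be i.i.d. from $\rho$, assume $g^\star\in\mathcal{G}$ with $\|g^\star\|_{\mathcal{G}}\le D$. Let $C^2=1+\sup_{y\in\mathcal{Y}}\|\phi(y)-\nabla h^*(0)\|_2/(\kappa\beta D)$ and run ASGD with constant step size $\eta=2/(\beta\kappa^2C^2\sqrt n)$. Then $$\mathbb{E}\big[\mathcal{E}(d\circ\widehat g_n)-\mathcal{E}(f^\star)\big]\le\frac{4\,\kappa\,c_{\psi}\,\beta\,D\,C}{n^{1/4}},\qquad c_\psi=\max_{z\in\mathcal{Z}}\|\psi(z)\|_2.$$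
   Context: $\mathcal{Y},\mathcal{Z}$ finite sets, $\mathcal{H}=\mathbb{R}^{k'}$ with Euclidean inner product, $\psi:\mathcal{Z}\to\mathcal{H}$, $\phi:\mathcal{Y}\to\mathcal{H}$, $c\in\mathbb{R}$, $L(z,y)=\langle\psi(z),\phi(y)\rangle+c$; $\mathcal{M}=\operatorname{hull}(\phi(\mathcal{Y}))$. $z(u)$ denotes an element of $\arg\min_z\langle\psi(z),u\rangle$ (fixed tie-breaking). $h:\mathcal{D}\to\mathbb{R}$ is of Legendre type (strictly convex on $\operatorname{int}\mathcal{D}$, differentiable there, with $\|\nabla h(u)\|\to\infty$ as $u\to\partial\mathcal{D}$) on a convex set $\mathcal{D}\supseteq\mathcal{M}$, and its Fenchel conjugate $h^*(v)=\sup_{u\in\mathcal{D}}\{\langle v,u\rangle-h(u)\}$ is finite and differentiable on all of $\mathcal{V}=\mathbb{R}^{k'}$. The Legendre-type loss is $S(v,y)=h^*(v)+h(\phi(y))-\langle\phi(y),v\rangle$, with decoding $d(v)=z(\nabla h^*(v))$. $\rho$ is a probability measure on $\mathcal{X}\times\mathcal{Y}$; $\mathcal{E}(f)=\mathbb{E}_\rho L(f(X),Y)$, $\mathcal{R}(g)=\mathbb{E}_\rho S(g(X),Y)$; $f^\star$ minimizes $\mathcal{E}$ over all measurable $f$ and $g^\star$ minimizes $\mathcal{R}$ over all measurable $g:\mathcal{X}\to\mathcal{V}$. $\bar{\mathcal{G}}$ is a scalar RKHS on $\mathcal{X}$ with kernel $k$, $\sup_x k(x,x)\le\kappa^2$;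 $\mathcal{G}=\bar{\mathcal{G}}^{k'}$ with $\|g\|_{\mathcal{G}}^2=\sum_{j=1}^{k'}\|g_j\|_{\bar{\mathcal{G}}}^2$. ASGD: $g_0=0$, $g_i=\Pi_D\big(g_{i-1}-\eta\nabla_v S(g_{i-1}(x_i),y_i)\otimes k(x_i,\cdot)\big)$, where $\Pi_D$ is the projection onto the ball of radius $D$ in $\mathcal{G}$, and $\widehat g_n=\frac1n\sum_{i=1}^n g_i$. *)

theory Defs
  imports "HOL-Probability.Probability"
begin

definition strict_convex_on :: "'a::real_vector set \<Rightarrow> ('a \<Rightarrow> real) \<Rightarrow> bool" where
  "strict_convex_on S f \<longleftrightarrow>
     (\<forall>x\<in>S. \<forall>y\<in>S. x \<noteq> y \<longrightarrow> (\<forall>t::real. 0 < t \<and> t < 1 \<longrightarrow>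
        f (t *\<^sub>R x + (1 - t) *\<^sub>R y) < t * f x + (1 - t) * f y))"

definition strongly_convex_on :: "real \<Rightarrow> 'a::real_normed_vector set \<Rightarrow> ('a \<Rightarrow> real) \<Rightarrow> bool" where
  "strongly_convex_on mu S f \<longleftrightarrow>
     (\<forall>x\<in>S. \<forall>y\<in>S. \<forall>t::real. 0 \<le> t \<and> t \<le> 1 \<longrightarrow>
        f (t *\<^sub>R x + (1 - t) *\<^sub>R y)
          \<le> t * f x + (1 - t) * f y - mu / 2 * t * (1 - t) * (norm (x - y))\<^sup>2)"

definition grad :: "('a::real_inner \<Rightarrow> real) \<Rightarrow> 'a \<Rightarrow> 'a" where
  "grad f u = (SOME D. GDERIV f u :> D)"

definition fconj :: "'a::real_inner set \<Rightarrow> ('a \<Rightarrow> real) \<Rightarrow> 'a \<Rightarrow> real" where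
  "fconj Dom h v = (SUP u\<in>Dom. v \<bullet> u - h u)"

definition legendre_type :: "'a::euclidean_space set \<Rightarrow> ('a \<Rightarrow> real) \<Rightarrow> bool" where
  "legendre_type Dom h \<longleftrightarrow>
     convex Dom \<and>
     strict_convex_on (interior Dom) h \<and>
     (\<forall>u\<in>interior Dom. h differentiable (at u)) \<and>
     (\<forall>(u::nat \<Rightarrow> 'a) b. (\<forall>m. u m \<in> interior Dom) \<and> b \<in> frontier Dom \<and> u \<longlonglongrightarrow> b
          \<longrightarrow> filterlim (\<lambda>m. norm (grad h (u m))) at_top sequentially)"

text \<open>Decoding with fixed tie-breaking: the least minimiser w.r.t. the linear order on 'z.\<close>
definition zdec :: "('z::{finite,linorder} \<Rightarrow> 'v::real_inner) \<Rightarrow> 'v \<Rightarrow> 'z" where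
  "zdec psi u = (LEAST z. \<forall>z'. psi z \<bullet> u \<le> psi z' \<bullet> u)"

definition Lloss :: "('z \<Rightarrow> 'v::real_inner) \<Rightarrow> ('y \<Rightarrow> 'v) \<Rightarrow> real \<Rightarrow> 'z \<Rightarrow> 'y \<Rightarrow> real" where
  "Lloss psi phi c z y = psi z \<bullet> phi y + c"

definition Sloss :: "'v::real_inner set \<Rightarrow> ('v \<Rightarrow> real) \<Rightarrow> ('y \<Rightarrow> 'v) \<Rightarrow> 'v \<Rightarrow> 'y \<Rightarrow> real" where
  "Sloss Dom h phi v y = fconj Dom h v + h (phi y) - phi y \<bullet> v"

definition decode :: "('z::{finite,linorder} \<Rightarrow> 'v::real_inner) \<Rightarrow> 'v set \<Rightarrow> ('v \<Rightarrow> real) \<Rightarrow> 'v \<Rightarrow> 'z" where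
  "decode psi Dom h v = zdec psi (grad (fconj Dom h) v)"

definition Erisk :: "('x \<times> 'y) measure \<Rightarrow> ('z \<Rightarrow> 'v::real_inner) \<Rightarrow> ('y \<Rightarrow> 'v) \<Rightarrow> real
                     \<Rightarrow> ('x \<Rightarrow> 'z) \<Rightarrow> real" where
  "Erisk rho psi phi c f = (\<integral>p. Lloss psi phi c (f (fst p)) (snd p) \<partial>rho)"

definition Rrisk :: "('x \<times> 'y) measure \<Rightarrow> 'v::real_inner set \<Rightarrow> ('v \<Rightarrow> real) \<Rightarrow> ('y \<Rightarrow> 'v)
                     \<Rightarrow> ('x \<Rightarrow> 'v) \<Rightarrow> ennreal" where
  "Rrisk rho Dom h phi g = (\<integral>\<^sup>+p. ennreal (Sloss Dom h phi (g (fst p)) (snd p)) \<partial>rho)"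

text \<open>The scalar RKHS is modelled as a Hilbert space 'g together with the representers
  kx x (so k(x,x') = <kx x, kx x'>); an element g is the function x \<mapsto> <kx x, g>.
  The vector-valued space is 'g^'k with the product (sum of squares) norm.\<close>
definition evalv :: "('x \<Rightarrow> 'g::real_inner) \<Rightarrow> 'g^'k \<Rightarrow> 'x \<Rightarrow> real^'k" where
  "evalv kx G x = (\<chi> j. kx x \<bullet> (G $ j))"

definition projD :: "real \<Rightarrow> 'a::real_normed_vector \<Rightarrow> 'a" where
  "projD D g = (if norm g \<le> D then g else (D / norm g) *\<^sub>R g)"

text \<open>ASGD iterates g_0 = 0, g_{i+1} built from sample s i (the paper's (x_{i+1}, y_{i+1})).\<close>
primrec asgd_iter :: "('x \<Rightarrow> 'g::real_inner) \<Rightarrow> (real^'k \<Rightarrow> 'y \<Rightarrow> real^'k) \<Rightarrow> real \<Rightarrow> real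
                      \<Rightarrow> (nat \<Rightarrow> 'x \<times> 'y) \<Rightarrow> nat \<Rightarrow> 'g^'k" where
  "asgd_iter kx gS eta D s 0 = 0"
| "asgd_iter kx gS eta D s (Suc i) =
     (let G = asgd_iter kx gS eta D s i; x = fst (s i); y = snd (s i);
          w = gS (evalv kx G x) y
      in projD D (G - eta *\<^sub>R (\<chi> j. (w $ j) *\<^sub>R kx x)))"

definition asgd_avg :: "('x \<Rightarrow> 'g::real_inner) \<Rightarrow> (real^'k \<Rightarrow> 'y \<Rightarrow> real^'k) \<Rightarrow> real \<Rightarrow> real
                      \<Rightarrow> (nat \<Rightarrow> 'x \<times> 'y) \<Rightarrow> nat \<Rightarrow> 'g^'k" where
  "asgd_avg kx gS eta D s n = (1 / real n) *\<^sub>R (\<Sum>i=1..n. asgd_iter kx gS eta D s i)"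

end

theory Submission
  imports Defs
begin

text \<open>Strong convexity of \<open>h\<close> makes \<open>h\<^sup>*\<close> convex and \<open>\<beta>\<close>-smooth, so the Bregman divergence of \<open>h\<^sup>*\<close>
  dominates \<open>\<parallel>\<nabla>h\<^sup>*(v) - \<nabla>h\<^sup>*(w)\<parallel>\<^sup>2 / (2\<beta>)\<close>. Minimality of \<open>g\<^sup>\<star>\<close> says that \<open>\<nabla>h\<^sup>*(g\<^sup>\<star>(X)) - \<phi>(Y)\<close> is
  orthogonal to every bounded function of \<open>X\<close>; hence the excess risk of the decoded predictor is at
  most \<open>2 c\<^sub>\<psi>\<close> times the expected distance of \<open>\<nabla>h\<^sup>*(g)\<close> and \<open>\<nabla>h\<^sup>*(g\<^sup>\<star>)\<close>, whose square is bounded by \<open>2\<beta>\<close>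
  times the excess surrogate risk. The latter is convex in \<open>g\<close> and is controlled by the usual
  potential argument for projected stochastic gradient descent.

  The RKHS need not be separable, so the iterates need not depend measurably on the sample. The
  potential argument is therefore run on iterated integrals, conditionally on each fixed past, and
  only the final decoded risk is ever assumed to be measurable. For \<open>n \<ge> 2\<close> this gives the constant
  \<open>4\<close>; for \<open>n = 1\<close> the Lipschitz bound on \<open>\<nabla>h\<^sup>*\<close> suffices.\<close>

section \<open>Smoothness of the Fenchel conjugate\<close>

lemma grad_eqI:
  assumes "GDERIV f v :> d"
  shows "grad f v = d"
proof -
  have "GDERIV f v :> grad f v"
    unfolding grad_def using assms by (rule someI)
  then have "(\<lambda>h. h \<bullet> grad f v) = (\<lambda>h. h \<bullet> d)"
    using assms unfolding gderiv_def by (rule has_derivative_unique)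
  then show ?thesis
    by (metis vector_eq_ldot)
qed

text \<open>In finite dimension the derivative is a linear functional, hence the inner product with
  the vector of its values on the basis. This vector witnesses the choice in
  \<open>grad\<close>.\<close>

lemma GDERIV_grad:
  fixes f :: "'a::euclidean_space \<Rightarrow> real"
  assumes "f differentiable (at v)"
  shows "GDERIV f v :> grad f v"
proof -
  obtain f' where f': "(f has_derivative f') (at v)"
    using assms by (auto simp: differentiable_def)
  then interpret linear f' by (rule has_derivative_linear)
  have "f' = (\<lambda>h. h \<bullet> (\<Sum>b\<in>Basis. f' b *\<^sub>R b))"
  proof
    fix h
    have "f' h = f' (\<Sum>b\<in>Basis. (h \<bullet> b) *\<^sub>R b)"
      by (simp add: euclidean_representation)
    also have "\<dots> = (\<Sum>b\<in>Basis. (h \<bullet> b) * f' b)"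
      by (simp add: sum scale)
    finally show "f' h = h \<bullet> (\<Sum>b\<in>Basis. f' b *\<^sub>R b)"
      by (simp add: inner_sum_right mult.commute)
  qed
  then have "GDERIV f v :> (\<Sum>b\<in>Basis. f' b *\<^sub>R b)"
    using f' by (simp add: gderiv_def)
  then show ?thesis
    unfolding grad_def by (rule someI)
qed

text \<open>The limit is one-sided because the difference quotients below are estimated only for
  \<open>t\<close> in (0,1).\<close>

lemma GDERIV_directional_limit:
  assumes "GDERIV f v :> d"
  shows "((\<lambda>t. (f (v + t *\<^sub>R u) - f v) / t) \<longlongrightarrow> d \<bullet> u) (at_right 0)"
proof -
  have "((\<lambda>t. f (v + t *\<^sub>R u)) has_derivative (\<lambda>t. (t *\<^sub>R u) \<bullet> d)) (at 0)"
  proof (rule has_derivative_compose[where f = "\<lambda>t. v + t *\<^sub>R u"])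
    show "((\<lambda>t. v + t *\<^sub>R u) has_derivative (\<lambda>t. t *\<^sub>R u)) (at 0)"
      by (auto intro!: derivative_eq_intros)
    show "(f has_derivative (\<lambda>h. h \<bullet> d)) (at (v + 0 *\<^sub>R u))"
      using assms by (simp add: gderiv_def)
  qed
  then have "((\<lambda>t. f (v + t *\<^sub>R u)) has_real_derivative (d \<bullet> u)) (at 0)"
    by (simp add: has_field_derivative_def inner_commute mult_commute_abs)
  then have "((\<lambda>t. (f (v + t *\<^sub>R u) - f v) / t) \<longlongrightarrow> d \<bullet> u) (at 0)"
    by (simp add: has_field_derivative_iff)
  then show ?thesis
    by (simp add: filterlim_at_split)
qed

lemma fconj_ge:
  assumes "bdd_above ((\<lambda>u. v \<bullet> u - h u) ` Dom)" "u \<in> Dom"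
  shows "v \<bullet> u - h u \<le> fconj Dom h v"
  unfolding fconj_def by (rule cSUP_upper[OF assms(2,1)])

lemma fconj_le:
  assumes "Dom \<noteq> {}" "\<And>u. u \<in> Dom \<Longrightarrow> v \<bullet> u - h u \<le> b"
  shows "fconj Dom h v \<le> b"
  unfolding fconj_def by (rule cSUP_least[OF assms])

text \<open>Each \<open>u\<close> in the domain contributes a function affine in \<open>v\<close>,
  and a supremum of affine functions is convex.\<close>

lemma fconj_convex_combination:
  assumes "Dom \<noteq> {}" "\<And>v. bdd_above ((\<lambda>u. v \<bullet> u - h u) ` Dom)" "0 \<le> t" "t \<le> 1"
  shows "fconj Dom h (t *\<^sub>R v1 + (1 - t) *\<^sub>R v2) \<le> t * fconj Dom h v1 + (1 - t) * fconj Dom h v2"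
proof (rule fconj_le[OF assms(1)])
  fix u assume u: "u \<in> Dom"
  have "(t *\<^sub>R v1 + (1 - t) *\<^sub>R v2) \<bullet> u - h u = t * (v1 \<bullet> u - h u) + (1 - t) * (v2 \<bullet> u - h u)"
    by (simp add: inner_add_left algebra_simps)
  also have "\<dots> \<le> t * fconj Dom h v1 + (1 - t) * fconj Dom h v2"
    using assms u by (intro add_mono mult_left_mono fconj_ge) auto
  finally show "(t *\<^sub>R v1 + (1 - t) *\<^sub>R v2) \<bullet> u - h u \<le> t * fconj Dom h v1 + (1 - t) * fconj Dom h v2" .
qed

text \<open>Working with arbitrary points of the domain instead of maximisers, no closedness of the
  domain or lower semicontinuity of \<open>h\<close> is required.\<close>

lemma fconj_smooth_combination:
  fixes h :: "'a::euclidean_space \<Rightarrow> real"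
  assumes "convex Dom" "Dom \<noteq> {}" "\<And>v. bdd_above ((\<lambda>u. v \<bullet> u - h u) ` Dom)"
    and sc: "strongly_convex_on (1 / beta) Dom h" and beta: "beta > 0" and t: "0 < t" "t < 1"
  shows "t * fconj Dom h v1 + (1 - t) * fconj Dom h v2
           \<le> fconj Dom h (t *\<^sub>R v1 + (1 - t) *\<^sub>R v2) + beta / 2 * t * (1 - t) * (norm (v1 - v2))\<^sup>2"
    (is "_ \<le> ?R")
proof -
  have key: "t * (v1 \<bullet> u1 - h u1) + (1 - t) * (v2 \<bullet> u2 - h u2) \<le> ?R"
    if u: "u1 \<in> Dom" "u2 \<in> Dom" for u1 u2
  proof -
    define u where "u = t *\<^sub>R u1 + (1 - t) *\<^sub>R u2"
    have "u \<in> Dom"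
      unfolding u_def using assms(1) u t by (intro convexD) auto
    then have 1: "(t *\<^sub>R v1 + (1 - t) *\<^sub>R v2) \<bullet> u - h u \<le> fconj Dom h (t *\<^sub>R v1 + (1 - t) *\<^sub>R v2)"
      by (intro fconj_ge assms)
    have 2: "h u \<le> t * h u1 + (1 - t) * h u2 - 1 / beta / 2 * t * (1 - t) * (norm (u1 - u2))\<^sup>2"
      using sc u t unfolding strongly_convex_on_def u_def by auto
    have 3: "(t *\<^sub>R v1 + (1 - t) *\<^sub>R v2) \<bullet> u
        = t * (v1 \<bullet> u1) + (1 - t) * (v2 \<bullet> u2) - t * (1 - t) * ((v1 - v2) \<bullet> (u1 - u2))"
      unfolding u_def by (simp add: inner_add_left inner_add_right inner_diff_left inner_diff_right algebra_simps)
    have sq: "(norm (beta *\<^sub>R a - b))\<^sup>2 = beta\<^sup>2 * (norm a)\<^sup>2 - 2 * beta * (a \<bullet> b) + (norm b)\<^sup>2"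
      for a b :: 'a
      unfolding power2_norm_eq_inner
      by (simp add: inner_diff_left inner_diff_right inner_commute power2_eq_square)
    \<comment> \<open>Young's inequality as a nonnegative square: the cross term
      \<open>(v1 - v2) \<bullet> (u1 - u2)\<close> left over by mixing both pairs is absorbed by the
      strong convexity gain and the quadratic term in \<open>v1 - v2\<close>.\<close>
    have "0 \<le> (norm (beta *\<^sub>R (v1 - v2) - (u1 - u2)))\<^sup>2 / (2 * beta)"
      using beta by simp
    also have "\<dots> = beta / 2 * (norm (v1 - v2))\<^sup>2 - (v1 - v2) \<bullet> (u1 - u2) + 1 / beta / 2 * (norm (u1 - u2))\<^sup>2"
      unfolding sq using beta by (simp add: add_divide_distrib diff_divide_distrib power2_eq_square)
    finally have "0 \<le> t * (1 - t) * \<dots>"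
      using t by simp
    then show ?thesis
      using 1 2 3 by (simp add: algebra_simps)
  qed
  \<comment> \<open>The two suprema are taken in turn: first over \<open>u2\<close> with
    \<open>u1\<close> fixed, then over \<open>u1\<close>.\<close>
  have *: "t * (v1 \<bullet> u1 - h u1) \<le> ?R - (1 - t) * fconj Dom h v2" if u1: "u1 \<in> Dom" for u1
  proof -
    have "fconj Dom h v2 \<le> (?R - t * (v1 \<bullet> u1 - h u1)) / (1 - t)"
      using key[OF u1] t by (intro fconj_le assms) (simp add: field_simps)
    then show ?thesis
      using t by (simp add: field_simps)
  qed
  have "fconj Dom h v1 \<le> (?R - (1 - t) * fconj Dom h v2) / t"
    using * t by (intro fconj_le assms) (simp add: field_simps)
  then show ?thesis
    using t by (simp add: field_simps)
qed

text \<open>Convexity and smoothness are packaged as a tangent lower bound and a quadratic upper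
  bound with a common slope; together they force \<open>gH\<close> to be the gradient of
  \<open>H\<close>.\<close>

locale smooth_convex =
  fixes H :: "'v::euclidean_space \<Rightarrow> real" and gH :: "'v \<Rightarrow> 'v" and beta :: real
  assumes beta_pos: "beta > 0"
    and lower: "H v + gH v \<bullet> (w - v) \<le> H w"
    and upper: "H w \<le> H v + gH v \<bullet> (w - v) + beta / 2 * (norm (w - v))\<^sup>2"
begin

text \<open>Compare the tangent plane at \<open>v\<close> with the quadratic upper bound at \<open>w\<close>, both at the point
  reached from \<open>w\<close> by a gradient step for \<open>\<lambda>u. H u - gH v \<bullet> u\<close>.\<close>

lemma gradient_gap:
  "(norm (gH w - gH v))\<^sup>2 / (2 * beta) \<le> H w - H v - gH v \<bullet> (w - v)"
proof -
  define d where "d = gH w - gH v"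
  define z where "z = w - (1 / beta) *\<^sub>R d"
  have 1: "H v + gH v \<bullet> (z - v) \<le> H w + gH w \<bullet> (z - w) + beta / 2 * (norm (z - w))\<^sup>2"
    using lower[of v z] upper[of z w] by linarith
  have 2: "gH v \<bullet> (z - v) - gH w \<bullet> (z - w) = gH v \<bullet> (w - v) + (norm d)\<^sup>2 / beta"
    unfolding z_def power2_norm_eq_inner
    by (simp add: d_def inner_diff_left inner_diff_right algebra_simps diff_divide_distrib add_divide_distrib)
  have "z - w = - (1 / beta) *\<^sub>R d"
    by (simp add: z_def)
  then have "norm (z - w) = norm d / beta"
    using beta_pos by simp
  then have 3: "beta / 2 * (norm (z - w))\<^sup>2 = (norm d)\<^sup>2 / (2 * beta)"
    using beta_pos by (simp add: power2_eq_square field_simps)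
  have "(norm d)\<^sup>2 / beta = 2 * ((norm d)\<^sup>2 / (2 * beta))"
    by simp
  then show ?thesis
    using 1 2 3 unfolding d_def by linarith
qed

text \<open>Adding \<open>gradient_gap\<close> for both orders of the two points gives cocoercivity;
  Cauchy-Schwarz then allows one factor to be cancelled.\<close>

lemma gradient_lipschitz: "norm (gH w - gH v) \<le> beta * norm (w - v)"
proof -
  have "(norm (gH w - gH v))\<^sup>2 / beta \<le> (gH w - gH v) \<bullet> (w - v)"
    using gradient_gap[of w v] gradient_gap[of v w] beta_pos
    by (simp add: norm_minus_commute inner_diff_left inner_diff_right field_simps)
  also have "\<dots> \<le> norm (gH w - gH v) * norm (w - v)"
    by (rule norm_cauchy_schwarz)
  finally have "norm (gH w - gH v) * norm (gH w - gH v) \<le> norm (gH w - gH v) * (beta * norm (w - v))"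
    using beta_pos by (simp add: power2_eq_square field_simps)
  then show ?thesis
    using beta_pos by (cases "gH w = gH v") auto
qed

lemma continuous_gradient: "continuous_on A gH"
proof -
  have "beta-lipschitz_on A gH"
    using gradient_lipschitz beta_pos by (intro lipschitz_onI) (auto simp: dist_norm)
  then show ?thesis
    by (rule lipschitz_on_continuous_on)
qed

text \<open>Averaging the tangent inequalities at the intermediate point \<open>z\<close> cancels
  the slope terms, since \<open>z\<close> is the barycentre.\<close>

lemma convex_H: "convex_on UNIV H"
proof (rule convex_onI)
  fix t :: real and x y :: 'v assume t: "0 < t" "t < 1"
  define z where "z = (1 - t) *\<^sub>R x + t *\<^sub>R y"
  have "(1 - t) * (H z + gH z \<bullet> (x - z)) + t * (H z + gH z \<bullet> (y - z)) \<le> (1 - t) * H x + t * H y"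
    using t lower by (intro add_mono mult_left_mono) auto
  also have "(1 - t) * (H z + gH z \<bullet> (x - z)) + t * (H z + gH z \<bullet> (y - z))
      = H z + gH z \<bullet> (((1 - t) *\<^sub>R x + t *\<^sub>R y) - z)"
    by (simp add: inner_diff_right inner_add_right algebra_simps)
  also have "\<dots> = H z"
    by (simp add: z_def)
  finally show "H ((1 - t) *\<^sub>R x + t *\<^sub>R y) \<le> (1 - t) * H x + t * H y"
    by (simp add: z_def)
qed simp

lemma continuous_H: "continuous_on A H"
  using convex_on_continuous[OF open_UNIV convex_H] continuous_on_subset by blast

end

text \<open>Both bounds come from the two combination inequalities on the segment from
  \<open>v\<close> to \<open>w\<close>: divide by \<open>t\<close> and let \<open>t\<close> tend to
  0 from the right.\<close>

lemma smooth_convex_fconj: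
  fixes h :: "'a::euclidean_space \<Rightarrow> real"
  assumes "convex Dom" "Dom \<noteq> {}" "\<And>v. bdd_above ((\<lambda>u. v \<bullet> u - h u) ` Dom)"
    and diff: "\<And>v. fconj Dom h differentiable (at v)"
    and "strongly_convex_on (1 / beta) Dom h" "beta > 0"
  shows "smooth_convex (fconj Dom h) (grad (fconj Dom h)) beta"
proof
  let ?H = "fconj Dom h"
  show "beta > 0" by fact
  fix v w
  have lim: "((\<lambda>t. (?H (v + t *\<^sub>R (w - v)) - ?H v) / t) \<longlongrightarrow> grad ?H v \<bullet> (w - v)) (at_right 0)"
    by (intro GDERIV_directional_limit GDERIV_grad diff)
  have ev: "eventually (\<lambda>t. t \<in> {0<..<1::real}) (at_right 0)"
    by (rule eventually_at_right_real) simp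
  have seg: "v + t *\<^sub>R (w - v) = t *\<^sub>R w + (1 - t) *\<^sub>R v" for t
    by (simp add: algebra_simps)
  have "grad ?H v \<bullet> (w - v) \<le> ?H w - ?H v"
  proof (rule tendsto_upperbound[OF lim])
    show "eventually (\<lambda>t. (?H (v + t *\<^sub>R (w - v)) - ?H v) / t \<le> ?H w - ?H v) (at_right 0)"
      using ev
    proof eventually_elim
      case (elim t)
      then have "?H (v + t *\<^sub>R (w - v)) \<le> t * ?H w + (1 - t) * ?H v"
        unfolding seg by (intro fconj_convex_combination assms) auto
      then show ?case
        using elim by (simp add: field_simps)
    qed
  qed simp
  then show "?H v + grad ?H v \<bullet> (w - v) \<le> ?H w"
    by simp
  have "((\<lambda>t. ?H w - ?H v - beta / 2 * (1 - t) * (norm (w - v))\<^sup>2)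
      \<longlongrightarrow> ?H w - ?H v - beta / 2 * (1 - 0) * (norm (w - v))\<^sup>2) (at_right 0)"
    by (intro tendsto_intros)
  then have "?H w - ?H v - beta / 2 * (1 - 0) * (norm (w - v))\<^sup>2 \<le> grad ?H v \<bullet> (w - v)"
  proof (rule tendsto_le[OF _ lim, rotated])
    show "eventually (\<lambda>t. ?H w - ?H v - beta / 2 * (1 - t) * (norm (w - v))\<^sup>2
        \<le> (?H (v + t *\<^sub>R (w - v)) - ?H v) / t) (at_right 0)"
      using ev
    proof eventually_elim
      case (elim t)
      then have "t * ?H w + (1 - t) * ?H v
          \<le> ?H (v + t *\<^sub>R (w - v)) + beta / 2 * t * (1 - t) * (norm (w - v))\<^sup>2"
        unfolding seg by (intro fconj_smooth_combination assms) auto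
      then show ?case
        using elim by (simp add: field_simps)
    qed
  qed simp
  then show "?H w \<le> ?H v + grad ?H v \<bullet> (w - v) + beta / 2 * (norm (w - v))\<^sup>2"
    by simp
qed

section \<open>Iterated integrals and projected gradient steps\<close>

text \<open>The bounds \<open>\<Phi>\<close> need not be measurable: each step only compares, for a fixed past, with an
  integrable function of the next sample.\<close>

lemma (in prob_space) integral_PiM_le_backward:
  fixes F :: "(nat \<Rightarrow> 'a) \<Rightarrow> real" and \<Phi> :: "nat \<Rightarrow> (nat \<Rightarrow> 'a) \<Rightarrow> real"
  assumes "F \<in> borel_measurable (PiM {..<n} (\<lambda>_. M))"
    and "\<And>s. s \<in> space (PiM {..<n} (\<lambda>_. M)) \<Longrightarrow> \<bar>F s\<bar> \<le> K"
    and "\<And>s. s \<in> space (PiM {..<n} (\<lambda>_. M)) \<Longrightarrow> F s \<le> \<Phi> n s"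
    and "\<And>j s. j < n \<Longrightarrow> s \<in> space (PiM {..<j} (\<lambda>_. M)) \<Longrightarrow>
           \<exists>\<xi>. integrable M \<xi> \<and> (\<forall>x\<in>space M. \<Phi> (Suc j) (s(j := x)) \<le> \<xi> x) \<and> integral\<^sup>L M \<xi> \<le> \<Phi> j s"
  shows "(\<integral>s. F s \<partial>PiM {..<n} (\<lambda>_. M)) \<le> \<Phi> 0 (\<lambda>_. undefined)"
  using assms
proof (induction n arbitrary: F)
  case 0
  interpret P: prob_space "PiM {} (\<lambda>_. M) :: (nat \<Rightarrow> 'a) measure"
    by (rule prob_space_PiM) (rule prob_space_axioms)
  \<comment> \<open>The empty product is the counting measure on the single everywhere undefined
    function.\<close>
  have "(\<integral>s. F s \<partial>PiM {..<0::nat} (\<lambda>_. M)) = F (\<lambda>_. undefined)"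
    using P.prob_space by (simp add: PiM_empty lebesgue_integral_count_space_finite)
  then show ?case
    using 0(3)[of "\<lambda>_. undefined"] by (simp add: space_PiM)
next
  case (Suc n)
  interpret product_sigma_finite "\<lambda>_::nat. M" ..
  interpret P: prob_space "PiM {..<Suc n} (\<lambda>_. M)"
    by (rule prob_space_PiM) (rule prob_space_axioms)
  have ins: "{..<Suc n} = insert n {..<n}" by auto
  have upd: "s(n := x) \<in> space (PiM {..<Suc n} (\<lambda>_. M))"
    if "s \<in> space (PiM {..<n} (\<lambda>_. M))" "x \<in> space M" for s x
    using that by (auto simp: space_PiM ins intro!: PiE_fun_upd)
  \<comment> \<open>Integrating out the last sample gives a function of the first \<open>n\<close>
    samples that again satisfies the hypotheses, so the induction runs backward in time.\<close>
  define F' where "F' = (\<lambda>s. \<integral>x. F (s(n := x)) \<partial>M)"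
  have meas: "(\<lambda>x. F (s(n := x))) \<in> borel_measurable M"
    if "s \<in> space (PiM {..<n} (\<lambda>_. M))" for s
    using measurable_comp[OF measurable_component_update[OF that] Suc.prems(1)[unfolded ins]]
    by (simp add: comp_def)
  have int: "integrable M (\<lambda>x. F (s(n := x)))" if "s \<in> space (PiM {..<n} (\<lambda>_. M))" for s
    using Suc.prems(2) upd that by (intro integrable_const_bound[where B = K] AE_I2 meas) auto
  have "integrable (PiM {..<Suc n} (\<lambda>_. M)) F"
    using Suc.prems(1,2) by (intro P.integrable_const_bound[where B = K] AE_I2) auto
  then have "(\<integral>s. F s \<partial>PiM {..<Suc n} (\<lambda>_. M)) = (\<integral>s. F' s \<partial>PiM {..<n} (\<lambda>_. M))"
    unfolding ins F'_def by (intro product_integral_insert) auto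
  also have "\<dots> \<le> \<Phi> 0 (\<lambda>_. undefined)"
  proof (rule Suc.IH)
    have "(\<lambda>(s, x). F (s(n := x))) \<in> borel_measurable (PiM {..<n} (\<lambda>_. M) \<Otimes>\<^sub>M M)"
      using measurable_comp[OF measurable_add_dim Suc.prems(1)[unfolded ins]]
      by (simp add: comp_def case_prod_beta')
    then show "F' \<in> borel_measurable (PiM {..<n} (\<lambda>_. M))"
      unfolding F'_def by (rule borel_measurable_lebesgue_integral)
  next
    fix s assume s: "s \<in> space (PiM {..<n} (\<lambda>_. M))"
    have "norm (F' s) \<le> (\<integral>x. norm (F (s(n := x))) \<partial>M)"
      unfolding F'_def by (rule integral_norm_bound)
    also have "\<dots> \<le> (\<integral>x. K \<partial>M)"
      using Suc.prems(2) upd[OF s] int[OF s] by (intro integral_mono) auto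
    finally show "\<bar>F' s\<bar> \<le> K"
      by (simp add: prob_space)
    obtain \<xi> where \<xi>: "integrable M \<xi>" "\<forall>x\<in>space M. \<Phi> (Suc n) (s(n := x)) \<le> \<xi> x"
      "integral\<^sup>L M \<xi> \<le> \<Phi> n s"
      using Suc.prems(4)[OF lessI s] by blast
    have "F' s \<le> integral\<^sup>L M \<xi>"
      unfolding F'_def using \<xi>(2) Suc.prems(3)[OF upd[OF s]]
      by (intro integral_mono \<xi>(1) int[OF s]) (metis order_trans)
    with \<xi> show "F' s \<le> \<Phi> n s" by simp
  qed (use Suc.prems(4) in auto)
  finally show ?case .
qed

section \<open>Projection onto a ball and bounds on the iterates\<close>

lemma norm_projD_le: "0 \<le> D \<Longrightarrow> norm (projD D a) \<le> D"
  by (simp add: projD_def)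

text \<open>For \<open>a\<close> outside the ball put \<open>r = D / norm a\<close>. As
  \<open>b\<close> lies in the ball, Cauchy-Schwarz gives
  \<open>a \<bullet> b \<le> r * (a \<bullet> a)\<close>, and the squared distances differ by at
  least \<open>(1 - r)^2 * (a \<bullet> a)\<close>.\<close>

lemma norm_projD_diff_le:
  fixes a b :: "'a::real_inner"
  assumes "0 < D" "norm b \<le> D"
  shows "norm (projD D a - b) \<le> norm (a - b)"
proof (cases "norm a \<le> D")
  case False
  define r where "r = D / norm a"
  have a: "norm a > 0"
    using False assms(1) by linarith
  then have r: "0 < r" "r < 1" "r * norm a = D"
    using False assms(1) by (simp_all add: r_def field_simps)
  have p: "projD D a = r *\<^sub>R a"
    using False by (simp add: projD_def r_def)
  have "a \<bullet> b \<le> norm a * D"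
    using norm_cauchy_schwarz[of a b] assms(2) a
    by (meson less_imp_le mult_left_mono order_trans)
  also have "\<dots> = r * (a \<bullet> a)"
    using r(3) by (simp add: power2_norm_eq_inner[symmetric] power2_eq_square)
  finally have "(1 - r) * (a \<bullet> b) \<le> (1 - r) * (r * (a \<bullet> a))"
    using r by (intro mult_left_mono) auto
  moreover have "0 \<le> (1 - r)\<^sup>2 * (a \<bullet> a)"
    by simp
  ultimately have "(norm (r *\<^sub>R a - b))\<^sup>2 \<le> (norm (a - b))\<^sup>2"
    unfolding power2_norm_eq_inner
    by (simp add: inner_diff_left inner_diff_right inner_commute power2_eq_square algebra_simps)
  then show ?thesis
    unfolding p by (rule power2_le_imp_le) simp
qed (simp add: projD_def)

text \<open>Adaptedness of the iterates: a fresh sample \<open>j\<close> can be inserted without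
  disturbing the iterates up to index \<open>j\<close>.\<close>

lemma asgd_iter_cong:
  assumes "\<And>i. i < j \<Longrightarrow> s i = s' i"
  shows "asgd_iter kx gS eta D s j = asgd_iter kx gS eta D s' j"
  using assms by (induction j) (auto simp: Let_def)

lemma norm_asgd_iter_le: "0 \<le> D \<Longrightarrow> norm (asgd_iter kx gS eta D s j) \<le> D"
  by (cases j) (simp_all add: Let_def norm_projD_le)

lemma norm_asgd_avg_le:
  assumes "0 \<le> D" "n > 0"
  shows "norm (asgd_avg kx gS eta D s n) \<le> D"
proof -
  have "norm (\<Sum>i=1..n. asgd_iter kx gS eta D s i) \<le> (\<Sum>i=1..n. D)"
    by (intro sum_norm_le norm_asgd_iter_le assms)
  then show ?thesis
    using assms by (simp add: asgd_avg_def field_simps)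
qed

section \<open>Evaluation of vector-valued functions and rank-one tensors\<close>

lemma evalv_diff: "evalv kx (G - G') x = evalv kx G x - evalv kx G' x"
  by (simp add: evalv_def vec_eq_iff inner_diff_right)

lemma evalv_scaleR: "evalv kx (r *\<^sub>R G) x = r *\<^sub>R evalv kx G x"
  by (simp add: evalv_def vec_eq_iff)

lemma evalv_sum: "evalv kx (\<Sum>i\<in>I. G i) x = (\<Sum>i\<in>I. evalv kx (G i) x)"
  by (simp add: evalv_def vec_eq_iff inner_sum_right)

lemma norm_evalv_le: "norm (evalv kx G x) \<le> norm (kx x) * norm G"
proof -
  have "norm (evalv kx G x) \<le> L2_set (\<lambda>j. norm (kx x) * norm (G $ j)) UNIV"
    unfolding norm_vec_def evalv_def
    by (rule L2_set_mono) (auto simp: Cauchy_Schwarz_ineq2)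
  also have "\<dots> = norm (kx x) * norm G"
    unfolding norm_vec_def by (simp add: L2_set_right_distrib)
  finally show ?thesis .
qed

text \<open>The reproducing property: it converts pairings with the stochastic gradient in the
  function space into pointwise inner products.\<close>

lemma inner_tensor_evalv: "G \<bullet> (\<chi> j. (w $ j) *\<^sub>R kx x) = w \<bullet> evalv kx G x"
  by (simp add: inner_vec_def evalv_def inner_commute)

lemma norm_tensor: "norm (\<chi> j. (w $ j) *\<^sub>R k) = norm w * norm k"
proof -
  have "norm (\<chi> j. (w $ j) *\<^sub>R k) = L2_set (\<lambda>j. norm k * norm (w $ j)) UNIV"
    unfolding norm_vec_def by (simp add: mult.commute)
  also have "\<dots> = norm k * norm w"
    unfolding norm_vec_def by (simp add: L2_set_right_distrib)
  finally show ?thesis by simp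
qed

section \<open>Surrogate and target risk\<close>

text \<open>The type of decisions is finite, so the minimum is attained and the \<open>LEAST\<close>
  in \<open>zdec\<close> is a genuine minimiser.\<close>

lemma zdec_le: "psi (zdec psi u) \<bullet> u \<le> psi z \<bullet> u"
proof -
  define A where "A = {z. \<forall>z'. psi z \<bullet> u \<le> psi z' \<bullet> u}"
  have "finite (range (\<lambda>z. psi z \<bullet> u))" by simp
  then have "Min (range (\<lambda>z. psi z \<bullet> u)) \<in> range (\<lambda>z. psi z \<bullet> u)"
    by (rule Min_in) auto
  then obtain z0 where z0: "Min (range (\<lambda>z. psi z \<bullet> u)) = psi z0 \<bullet> u" by (rule imageE)
  have "psi z0 \<bullet> u \<le> psi z \<bullet> u" for z
    using Min_le[of "range (\<lambda>z. psi z \<bullet> u)" "psi z \<bullet> u"] z0 by simp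
  then have "z0 \<in> A"
    by (simp add: A_def)
  then have "zdec psi u = Min A"
    unfolding zdec_def by (subst Least_Min) (auto simp: A_def)
  then have "zdec psi u \<in> A"
    using \<open>z0 \<in> A\<close> by (metis Min_in empty_iff finite)
  then show ?thesis by (simp add: A_def)
qed

text \<open>This replaces \<open>LEAST\<close> by a finite Boolean combination of linear
  inequalities in \<open>u\<close>, from which measurability of the decoding is read off.\<close>

lemma zdec_eq_iff:
  "zdec psi u = z \<longleftrightarrow>
     (\<forall>z'. psi z \<bullet> u \<le> psi z' \<bullet> u) \<and> (\<forall>z1. (\<forall>z'. psi z1 \<bullet> u \<le> psi z' \<bullet> u) \<longrightarrow> z \<le> z1)"
    (is "?L \<longleftrightarrow> ?R")
proof
  assume L: ?L
  have "z \<le> z1" if "\<forall>z'. psi z1 \<bullet> u \<le> psi z' \<bullet> u" for z1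
  proof -
    have "zdec psi u = Min {z. \<forall>z'. psi z \<bullet> u \<le> psi z' \<bullet> u}"
      unfolding zdec_def using that by (intro Least_Min) auto
    then show ?thesis
      using L that by auto
  qed
  then show ?R
    using L zdec_le[of psi u] by auto
next
  assume ?R then show ?L
    unfolding zdec_def by (intro Least_equality) auto
qed

lemma measurable_zdec:
  fixes psi :: "'z::{finite,linorder} \<Rightarrow> 'v::euclidean_space"
  shows "zdec psi \<in> borel \<rightarrow>\<^sub>M count_space UNIV"
proof (subst measurable_count_space_eq2, goal_cases)
  case 2
  show ?case
  proof (intro conjI ballI)
    fix z
    have "Measurable.pred borel (\<lambda>u. (\<forall>z'. psi z \<bullet> u \<le> psi z' \<bullet> u) \<and>
        (\<forall>z1. (\<forall>z'. psi z1 \<bullet> u \<le> psi z' \<bullet> u) \<longrightarrow> z \<le> z1))"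
      by measurable
    then show "zdec psi -` {z} \<inter> space borel \<in> sets borel"
      by (simp add: pred_def zdec_eq_iff[symmetric] vimage_def)
  qed auto
qed simp

section \<open>Integrability under a bounded kernel and the first-order condition\<close>

locale rkhs_sample = smooth_convex H gH beta + prob_space rho
  for H :: "real^'k::finite \<Rightarrow> real" and gH beta and rho :: "('x \<times> 'y::finite) measure" +
  fixes MX :: "'x measure" and kx :: "'x \<Rightarrow> 'g::real_inner" and kappa :: real
    and phi :: "'y \<Rightarrow> real^'k"
  assumes sets_rho: "sets rho = sets (MX \<Otimes>\<^sub>M count_space UNIV)"
    and kx_meas: "kx \<in> borel_measurable MX"
    and kappa_pos: "kappa > 0"
    and kx_bound: "x \<in> space MX \<Longrightarrow> kx x \<bullet> kx x \<le> kappa\<^sup>2"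
begin

abbreviation ev :: "'g^'k \<Rightarrow> 'x \<Rightarrow> real^'k" where
  "ev \<equiv> evalv kx"

lemma space_rho: "space rho = space MX \<times> UNIV"
  using sets_eq_imp_space_eq[OF sets_rho] by (simp add: space_pair_measure)

lemma measurable_fst_rho [measurable]: "fst \<in> rho \<rightarrow>\<^sub>M MX"
  and measurable_snd_rho [measurable]: "snd \<in> rho \<rightarrow>\<^sub>M count_space UNIV"
  unfolding measurable_cong_sets[OF sets_rho refl] by simp_all

lemma norm_kx_le: "x \<in> space MX \<Longrightarrow> norm (kx x) \<le> kappa"
  by (rule power2_le_imp_le) (use kappa_pos in \<open>simp_all add: power2_norm_eq_inner kx_bound\<close>)

lemma norm_ev_le: "x \<in> space MX \<Longrightarrow> norm (ev G x) \<le> kappa * norm G"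
  by (rule order_trans[OF norm_evalv_le[of kx G x] mult_right_mono[OF norm_kx_le]]) auto

lemma measurable_ev [measurable]: "ev G \<in> borel_measurable MX"
proof -
  have "(\<lambda>x. kx x \<bullet> (G $ j)) \<in> borel_measurable MX" for j
    by (intro measurable_compose[OF kx_meas] borel_measurable_continuous_onI continuous_intros)
  then show ?thesis
    by (subst borel_measurable_euclidean_space) (auto simp: Basis_vec_def evalv_def inner_axis)
qed

lemma integrable_bounded:
  fixes f :: "'x \<times> 'y \<Rightarrow> real"
  assumes "f \<in> borel_measurable rho" "\<And>x y. x \<in> space MX \<Longrightarrow> \<bar>f (x, y)\<bar> \<le> B"
  shows "integrable rho f"
  using assms by (intro integrable_const_bound[where B = B] AE_I2) (auto simp: space_rho)

text \<open>For fixed \<open>G\<close> and \<open>G'\<close> the evaluations stay in compact balls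
  and there are finitely many labels, so a continuous expression in them is bounded.\<close>

lemma integrable_continuous:
  fixes T :: "'y \<Rightarrow> (real^'k) \<times> (real^'k) \<Rightarrow> real"
  assumes cont: "\<And>y. continuous_on UNIV (T y)"
  shows "integrable rho (\<lambda>p. T (snd p) (ev G (fst p), ev G' (fst p)))"
proof -
  let ?K = "cball 0 (kappa * norm G) \<times> cball 0 (kappa * norm G')"
  have "bounded (T y ` ?K)" for y
    using cont by (intro compact_imp_bounded compact_continuous_image compact_Times compact_cball)
      (auto intro: continuous_on_subset)
  then have "\<forall>y. \<exists>b. \<forall>u\<in>?K. \<bar>T y u\<bar> \<le> b"
    by (auto simp: bounded_iff)
  then obtain b where b: "\<And>y u. u \<in> ?K \<Longrightarrow> \<bar>T y u\<bar> \<le> b y"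
    by metis
  show ?thesis
  proof (rule integrable_bounded[where B = "\<Sum>y\<in>UNIV. \<bar>b y\<bar>"])
    show "(\<lambda>p. T (snd p) (ev G (fst p), ev G' (fst p))) \<in> borel_measurable rho"
    proof (rule measurable_compose_countable[where f = "\<lambda>y p. T y (ev G (fst p), ev G' (fst p))"])
      fix y
      show "(\<lambda>p. T y (ev G (fst p), ev G' (fst p))) \<in> borel_measurable rho"
        by (rule measurable_compose[OF _ borel_measurable_continuous_onI[OF cont]]) measurable
    qed simp
  next
    fix x y assume "x \<in> space MX"
    then have "\<bar>T y (ev G x, ev G' x)\<bar> \<le> \<bar>b y\<bar>"
      using b[of "(ev G x, ev G' x)" y] norm_ev_le[of x] by fastforce
    also have "\<dots> \<le> (\<Sum>y\<in>UNIV. \<bar>b y\<bar>)"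
      by (rule member_le_sum) auto
    finally show "\<bar>T (snd (x, y)) (ev G (fst (x, y)), ev G' (fst (x, y)))\<bar> \<le> (\<Sum>y\<in>UNIV. \<bar>b y\<bar>)"
      by simp
  qed
qed

lemmas continuous_compose_H_gH = continuous_on_compose2[OF continuous_H[of UNIV]]
  continuous_on_compose2[OF continuous_gradient[of UNIV]]

lemma measurable_gH [measurable]: "gH \<in> borel_measurable borel"
  by (intro borel_measurable_continuous_onI continuous_gradient)

lemma measurable_phi [measurable]: "(\<lambda>p. phi (snd p)) \<in> borel_measurable rho"
  by (rule measurable_compose[OF measurable_snd_rho]) simp

lemma norm_phi_le: "norm (phi y) \<le> (\<Sum>y\<in>UNIV. norm (phi y))"
  by (rule member_le_sum) auto

lemma integrable_inner_ev:
  assumes [measurable]: "q \<in> borel_measurable MX" and q: "\<And>x. x \<in> space MX \<Longrightarrow> norm (q x) \<le> B"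
  shows "integrable rho (\<lambda>p. q (fst p) \<bullet> gH (ev G (fst p)))"
    and "integrable rho (\<lambda>p. q (fst p) \<bullet> phi (snd p))"
proof -
  have bd: "\<bar>q x \<bullet> v\<bar> \<le> B * b" if "x \<in> space MX" "norm v \<le> b" for x v b
  proof -
    have "norm (q x) \<le> B" "0 \<le> B"
      using q[OF that(1)] norm_ge_zero[of "q x"] by linarith+
    then have "norm (q x) * norm v \<le> B * b"
      using that(2) by (intro mult_mono) auto
    then show ?thesis
      using Cauchy_Schwarz_ineq2[of "q x" v] by linarith
  qed
  have "bounded (gH ` cball 0 (kappa * norm G))"
    by (intro compact_imp_bounded compact_continuous_image continuous_gradient compact_cball)
  then obtain b where b: "\<And>v. norm v \<le> kappa * norm G \<Longrightarrow> norm (gH v) \<le> b"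
    unfolding bounded_iff by (metis image_eqI mem_cball_0)
  show "integrable rho (\<lambda>p. q (fst p) \<bullet> gH (ev G (fst p)))"
    by (rule integrable_bounded[where B = "B * b"]) (auto intro!: bd b norm_ev_le)
  show "integrable rho (\<lambda>p. q (fst p) \<bullet> phi (snd p))"
    by (rule integrable_bounded[where B = "B * (\<Sum>y\<in>UNIV. norm (phi y))"])
      (auto intro!: bd norm_phi_le)
qed

text \<open>Perturbing the minimiser by \<open>t *\<^sub>R q\<close> raises the risk, by the
  quadratic upper bound, by at most \<open>t * A\<close> plus a multiple of \<open>t^2\<close>.
  Minimality for both signs of \<open>t\<close> forces the linear coefficient \<open>A\<close> to
  vanish.\<close>

lemma stationary:
  assumes S_nonneg: "\<And>v y. 0 \<le> H v + a y - phi y \<bullet> v"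
    and min: "\<And>g. g \<in> borel_measurable MX \<Longrightarrow>
        (\<integral>\<^sup>+p. ennreal (H (ev G (fst p)) + a (snd p) - phi (snd p) \<bullet> ev G (fst p)) \<partial>rho)
          \<le> (\<integral>\<^sup>+p. ennreal (H (g (fst p)) + a (snd p) - phi (snd p) \<bullet> g (fst p)) \<partial>rho)"
    and [measurable]: "q \<in> borel_measurable MX" and q: "\<And>x. x \<in> space MX \<Longrightarrow> norm (q x) \<le> B"
  shows "(\<integral>p. q (fst p) \<bullet> (gH (ev G (fst p)) - phi (snd p)) \<partial>rho) = 0"
proof -
  define S :: "('x \<Rightarrow> real^'k) \<Rightarrow> 'x \<times> 'y \<Rightarrow> real"
    where "S = (\<lambda>g p. H (g (fst p)) + a (snd p) - phi (snd p) \<bullet> g (fst p))"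
  define A where "A = (\<integral>p. q (fst p) \<bullet> (gH (ev G (fst p)) - phi (snd p)) \<partial>rho)"
  have int0: "integrable rho (S (ev G))"
    unfolding S_def
    by (rule integrable_continuous[where T = "\<lambda>y u. H (fst u) + a y - phi y \<bullet> fst u", simplified])
      (intro continuous_intros continuous_compose_H_gH, auto)
  have intA: "integrable rho (\<lambda>p. q (fst p) \<bullet> (gH (ev G (fst p)) - phi (snd p)))"
    using integrable_inner_ev[OF assms(3) q] by (simp add: inner_diff_right)
  have step: "0 \<le> t * A + t\<^sup>2 * (beta / 2 * B\<^sup>2)" for t
  proof -
    define g where "g = (\<lambda>x. ev G x + t *\<^sub>R q x)"
    have [measurable]: "g \<in> borel_measurable MX"
      by (simp add: g_def)
    let ?U = "\<lambda>p. S (ev G) p + t * (q (fst p) \<bullet> (gH (ev G (fst p)) - phi (snd p))) + t\<^sup>2 * (beta / 2 * B\<^sup>2)"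
    have intU: "integrable rho ?U"
      using int0 intA by simp
    have le: "S g p \<le> ?U p" if "p \<in> space rho" for p
    proof -
      have "norm (q (fst p)) \<le> B"
        using that q by (auto simp: space_rho)
      then have "(norm (q (fst p)))\<^sup>2 \<le> B\<^sup>2"
        by (intro power_mono) auto
      then have "t\<^sup>2 * (beta / 2 * (norm (q (fst p)))\<^sup>2) \<le> t\<^sup>2 * (beta / 2 * B\<^sup>2)"
        using beta_pos by (intro mult_left_mono) auto
      moreover have "beta / 2 * (norm (t *\<^sub>R q (fst p)))\<^sup>2 = t\<^sup>2 * (beta / 2 * (norm (q (fst p)))\<^sup>2)"
        by (simp add: power_mult_distrib)
      ultimately show ?thesis
        using upper[of "g (fst p)" "ev G (fst p)"]
        by (simp add: S_def g_def inner_add_right inner_diff_right inner_commute algebra_simps)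
    qed
    \<comment> \<open>The perturbed loss \<open>S g\<close> occurs only under the nonnegative
      integral; its majorant \<open>?U\<close> is what gets integrated as a real function.\<close>
    have "ennreal (\<integral>p. S (ev G) p \<partial>rho) = (\<integral>\<^sup>+p. ennreal (S (ev G) p) \<partial>rho)"
      using int0 S_nonneg by (intro nn_integral_eq_integral[symmetric]) (auto simp: S_def)
    also have "\<dots> \<le> (\<integral>\<^sup>+p. ennreal (S g p) \<partial>rho)"
      unfolding S_def by (rule min) measurable
    also have "\<dots> \<le> (\<integral>\<^sup>+p. ennreal (?U p) \<partial>rho)"
      using le by (intro nn_integral_mono ennreal_leI)
    also have "\<dots> = ennreal (\<integral>p. ?U p \<partial>rho)"
    proof (rule nn_integral_eq_integral[OF intU])
      have "0 \<le> S g p" for p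
        using S_nonneg[of "g (fst p)" "snd p"] by (simp add: S_def)
      then show "AE p in rho. 0 \<le> ?U p"
        using le order_trans by (intro AE_I2) blast
    qed
    finally have "ennreal (\<integral>p. S (ev G) p \<partial>rho) \<le> ennreal (\<integral>p. ?U p \<partial>rho)" .
    moreover have "0 \<le> (\<integral>p. ?U p \<partial>rho)"
    proof (rule Bochner_Integration.integral_nonneg)
      fix p assume "p \<in> space rho"
      then show "0 \<le> ?U p"
        using le[of p] S_nonneg[of "g (fst p)" "snd p"] by (simp add: S_def)
    qed
    ultimately have "(\<integral>p. S (ev G) p \<partial>rho) \<le> (\<integral>p. ?U p \<partial>rho)"
      by (simp add: ennreal_le_iff)
    also have "\<dots> = (\<integral>p. S (ev G) p \<partial>rho) + t * A + t\<^sup>2 * (beta / 2 * B\<^sup>2)"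
      using int0 intA by (simp add: A_def prob_space)
    finally show ?thesis by simp
  qed
  define c where "c = beta / 2 * B\<^sup>2"
  have c: "c \<ge> 0" using beta_pos by (simp add: c_def)
  \<comment> \<open>At \<open>t = - r\<close> the quadratic bound collapses to \<open>- r^2\<close>;
    the denominator is \<open>c + 1\<close> because \<open>c\<close> may be 0.\<close>
  define r where "r = A / (c + 1)"
  have A: "A = r * (c + 1)" using c by (simp add: r_def)
  have "0 \<le> - r * A + r\<^sup>2 * c"
    using step[of "- r"] by (simp add: c_def)
  then have "r\<^sup>2 \<le> 0"
    unfolding A by (simp add: power2_eq_square algebra_simps)
  then have "r = 0" by simp
  then have "A = 0" using A by simp
  then show ?thesis unfolding A_def .
qed

end

text \<open>From here on minimality of \<open>Gs\<close> enters only as orthogonality: the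
  conditional mean of \<open>phi\<close> given the input is \<open>gH (ev Gs x)\<close>, tested
  against bounded functions of the input.\<close>

locale rkhs_minimizer = rkhs_sample H gH beta rho MX kx kappa phi
  for H :: "real^'k::finite \<Rightarrow> real" and gH beta and rho :: "('x \<times> 'y::finite) measure"
    and MX :: "'x measure" and kx :: "'x \<Rightarrow> 'g::real_inner" and kappa :: real
    and phi :: "'y \<Rightarrow> real^'k" +
  fixes Gs :: "'g^'k"
  assumes first_order: "q \<in> borel_measurable MX \<Longrightarrow> (\<And>x. x \<in> space MX \<Longrightarrow> norm (q x) \<le> B) \<Longrightarrow>
    (\<integral>p. q (fst p) \<bullet> (gH (ev Gs (fst p)) - phi (snd p)) \<partial>rho) = 0"
begin

text \<open>The excess surrogate risk over \<open>Gs\<close>: the terms \<open>h (phi y)\<close>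
  cancel in the difference of the losses.\<close>

definition excess :: "'g^'k \<Rightarrow> real" where
  "excess G = (\<integral>p. H (ev G (fst p)) - H (ev Gs (fst p))
                 - phi (snd p) \<bullet> (ev G (fst p) - ev Gs (fst p)) \<partial>rho)"

lemma integrable_excess:
  "integrable rho (\<lambda>p. H (ev G (fst p)) - H (ev Gs (fst p)) - phi (snd p) \<bullet> (ev G (fst p) - ev Gs (fst p)))"
  by (rule integrable_continuous[where T = "\<lambda>y u. H (fst u) - H (snd u) - phi y \<bullet> (fst u - snd u)",
        unfolded fst_conv snd_conv])
    (intro continuous_intros continuous_compose_H_gH, auto)

lemma integrable_gap:
  "integrable rho (\<lambda>p. norm (gH (ev G (fst p)) - gH (ev Gs (fst p))))"
  "integrable rho (\<lambda>p. (norm (gH (ev G (fst p)) - gH (ev Gs (fst p))))\<^sup>2)"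
  by (rule integrable_continuous[where T = "\<lambda>y u. norm (gH (fst u) - gH (snd u))",
        unfolded fst_conv snd_conv],
      intro continuous_intros continuous_compose_H_gH, auto)
    (rule integrable_continuous[where T = "\<lambda>y u. (norm (gH (fst u) - gH (snd u)))\<^sup>2",
        unfolded fst_conv snd_conv],
      intro continuous_intros continuous_compose_H_gH, auto)

lemma norm_ev_diff_le: "x \<in> space MX \<Longrightarrow> norm (ev G x - ev G' x) \<le> kappa * norm (G - G')"
  unfolding evalv_diff[symmetric] by (rule norm_ev_le)

text \<open>Pointwise, \<open>gradient_gap\<close> bounds the square by the Bregman divergence at
  \<open>ev Gs\<close>. By \<open>first_order\<close> with \<open>q = ev G - ev Gs\<close>, the
  slope \<open>gH (ev Gs x)\<close> may be replaced by \<open>phi y\<close> under the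
  integral.\<close>

lemma expected_gap_le_excess:
  "(\<integral>p. (norm (gH (ev G (fst p)) - gH (ev Gs (fst p))))\<^sup>2 \<partial>rho) \<le> 2 * beta * excess G"
proof -
  let ?d = "\<lambda>x. ev G x - ev Gs x"
  let ?T = "\<lambda>p. H (ev G (fst p)) - H (ev Gs (fst p)) - gH (ev Gs (fst p)) \<bullet> ?d (fst p)"
  have T: "integrable rho ?T"
    by (rule integrable_continuous[where T = "\<lambda>y u. H (fst u) - H (snd u) - gH (snd u) \<bullet> (fst u - snd u)",
          unfolded fst_conv snd_conv])
      (intro continuous_intros continuous_compose_H_gH, auto)
  have d: "?d \<in> borel_measurable MX" by measurable
  note b = norm_ev_diff_le[of _ G Gs]
  have d_int: "integrable rho (\<lambda>p. ?d (fst p) \<bullet> (gH (ev Gs (fst p)) - phi (snd p)))"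
    using integrable_inner_ev[OF d b] by (simp add: inner_diff_right)
  have "(\<integral>p. (norm (gH (ev G (fst p)) - gH (ev Gs (fst p))))\<^sup>2 \<partial>rho) \<le> (\<integral>p. 2 * beta * ?T p \<partial>rho)"
  proof (rule integral_mono[OF integrable_gap(2) integrable_mult_right[OF T]])
    fix p
    show "(norm (gH (ev G (fst p)) - gH (ev Gs (fst p))))\<^sup>2 \<le> 2 * beta * ?T p"
      using gradient_gap[of "ev G (fst p)" "ev Gs (fst p)"] beta_pos by (simp add: field_simps)
  qed
  also have "\<dots> = 2 * beta * ((\<integral>p. ?T p \<partial>rho)
      + (\<integral>p. ?d (fst p) \<bullet> (gH (ev Gs (fst p)) - phi (snd p)) \<partial>rho))"
    using first_order[OF d b] by simp
  also have "\<dots> = 2 * beta * (\<integral>p. ?T p + ?d (fst p) \<bullet> (gH (ev Gs (fst p)) - phi (snd p)) \<partial>rho)"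
    by (simp only: Bochner_Integration.integral_add[OF T d_int])
  also have "\<dots> = 2 * beta * excess G"
    unfolding excess_def
    by (simp add: inner_diff_right inner_diff_left inner_commute algebra_simps)
  finally show ?thesis .
qed

lemma excess_nonneg: "0 \<le> excess G"
proof -
  have "0 \<le> 2 * beta * excess G"
    by (rule order_trans[OF _ expected_gap_le_excess]) (rule Bochner_Integration.integral_nonneg, simp)
  then show ?thesis
    using beta_pos by (simp add: zero_le_mult_iff)
qed

lemma integrable_gradient:
  "integrable rho (\<lambda>p. (gH (ev G (fst p)) - phi (snd p)) \<bullet> (ev G (fst p) - ev Gs (fst p)))"
  by (rule integrable_continuous[where T = "\<lambda>y u. (gH (fst u) - phi y) \<bullet> (fst u - snd u)",
        unfolded fst_conv snd_conv])
    (intro continuous_intros continuous_compose_H_gH, auto)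

text \<open>The tangent at \<open>ev G\<close> is compared with \<open>H\<close> at
  \<open>ev Gs\<close>. The right-hand side is the expected decrease, per \<open>2 * eta\<close>, in
  the expansion of a gradient step.\<close>

lemma excess_le_gradient:
  "excess G \<le> (\<integral>p. (gH (ev G (fst p)) - phi (snd p)) \<bullet> (ev G (fst p) - ev Gs (fst p)) \<partial>rho)"
  unfolding excess_def
proof (rule integral_mono[OF integrable_excess integrable_gradient])
  fix p
  show "H (ev G (fst p)) - H (ev Gs (fst p)) - phi (snd p) \<bullet> (ev G (fst p) - ev Gs (fst p))
      \<le> (gH (ev G (fst p)) - phi (snd p)) \<bullet> (ev G (fst p) - ev Gs (fst p))"
    using lower[of "ev G (fst p)" "ev Gs (fst p)"] by (simp add: inner_diff_left inner_diff_right)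
qed

text \<open>Jensen's inequality for \<open>H\<close> at each input; the remaining terms are affine
  and average exactly.\<close>

lemma excess_average:
  fixes G :: "nat \<Rightarrow> 'g^'k"
  assumes "n > 0"
  shows "excess ((1 / real n) *\<^sub>R (\<Sum>i=1..n. G i)) \<le> (1 / real n) * (\<Sum>i=1..n. excess (G i))"
proof -
  let ?r = "1 / real n"
  let ?A = "?r *\<^sub>R (\<Sum>i=1..n. G i)"
  let ?e = "\<lambda>G p. H (ev G (fst p)) - H (ev Gs (fst p)) - phi (snd p) \<bullet> (ev G (fst p) - ev Gs (fst p))"
  have "excess ?A \<le> (\<integral>p. ?r * (\<Sum>i=1..n. ?e (G i) p) \<partial>rho)"
    unfolding excess_def
  proof (rule integral_mono[OF integrable_excess])
    show "integrable rho (\<lambda>p. ?r * (\<Sum>i=1..n. ?e (G i) p))"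
      by (intro integrable_mult_right Bochner_Integration.integrable_sum integrable_excess)
    fix p :: "'x \<times> 'y"
    obtain x y where p: "p = (x, y)" by (cases p)
    have A: "ev ?A x = (\<Sum>i=1..n. ?r *\<^sub>R ev (G i) x)"
      by (simp add: evalv_scaleR evalv_sum scaleR_sum_right)
    have "H (ev ?A x) \<le> (\<Sum>i=1..n. ?r * H (ev (G i) x))"
      unfolding A using assms by (intro convex_on_sum[OF _ _ convex_H]) auto
    moreover have "phi y \<bullet> ev ?A x = (\<Sum>i=1..n. ?r * (phi y \<bullet> ev (G i) x))"
      unfolding A by (simp add: inner_sum_right)
    moreover have "?r * (\<Sum>i=1..n. ?e (G i) p) = (\<Sum>i=1..n. ?r * H (ev (G i) x))
        - H (ev Gs x) - ((\<Sum>i=1..n. ?r * (phi y \<bullet> ev (G i) x)) - phi y \<bullet> ev Gs x)"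
      unfolding sum_distrib_left[symmetric] using assms
      by (simp add: p inner_diff_right sum_subtractf right_diff_distrib diff_divide_distrib)
    ultimately show "?e ?A p \<le> ?r * (\<Sum>i=1..n. ?e (G i) p)"
      by (simp add: p inner_diff_right)
  qed
  also have "\<dots> = ?r * (\<Sum>i=1..n. excess (G i))"
    unfolding excess_def
    by (simp only: integral_mult_right_zero Bochner_Integration.integral_sum[OF integrable_excess])
  finally show ?thesis .
qed

text \<open>The constant \<open>c\<close> cancels and the target loss is linear in
  \<open>phi y\<close>, so \<open>first_order\<close> replaces \<open>phi y\<close> by
  \<open>gH (ev Gs x)\<close>. Decoding is optimal for \<open>gH (ev G x)\<close> instead, and
  Cauchy-Schwarz pays for the discrepancy.\<close>

lemma Erisk_diff_le:
  fixes psi :: "'z::{finite,linorder} \<Rightarrow> real^'k"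
  assumes f: "f \<in> MX \<rightarrow>\<^sub>M count_space UNIV"
    and cpsi: "\<And>z. norm (psi z) \<le> cpsi"
  shows "Erisk rho psi phi c (\<lambda>x. zdec psi (gH (ev G x))) - Erisk rho psi phi c f
     \<le> 2 * cpsi * (\<integral>p. norm (gH (ev G (fst p)) - gH (ev Gs (fst p))) \<partial>rho)"
proof -
  let ?d = "\<lambda>x. zdec psi (gH (ev G x))"
  have d: "?d \<in> MX \<rightarrow>\<^sub>M count_space UNIV"
    by (rule measurable_compose[OF _ measurable_zdec]) measurable
  have psi_meas: "(\<lambda>x. psi (g x)) \<in> borel_measurable MX" if "g \<in> MX \<rightarrow>\<^sub>M count_space UNIV" for g
    by (rule measurable_compose[OF that]) simp
  define q where "q = (\<lambda>x. psi (?d x) - psi (f x))"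
  have qm: "q \<in> borel_measurable MX"
    unfolding q_def using psi_meas[OF d] psi_meas[OF f] by measurable
  have qb: "norm (q x) \<le> 2 * cpsi" for x
    unfolding q_def using norm_triangle_ineq4[of "psi (?d x)" "psi (f x)"] cpsi[of "?d x"] cpsi[of "f x"]
    by linarith
  note int = integrable_inner_ev[OF qm qb]
  have intL: "integrable rho (\<lambda>p. Lloss psi phi c (g (fst p)) (snd p))"
    if "g \<in> MX \<rightarrow>\<^sub>M count_space UNIV" for g
    unfolding Lloss_def using integrable_inner_ev(2)[OF psi_meas[OF that] cpsi] by simp
  have "Erisk rho psi phi c ?d - Erisk rho psi phi c f = (\<integral>p. q (fst p) \<bullet> phi (snd p) \<partial>rho)"
    unfolding Erisk_def Bochner_Integration.integral_diff[OF intL[OF d] intL[OF f], symmetric]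
    by (simp add: Lloss_def q_def inner_diff_left)
  also have "\<dots> = (\<integral>p. q (fst p) \<bullet> gH (ev Gs (fst p)) \<partial>rho)"
    using first_order[OF qm qb] int by (simp add: inner_diff_right)
  also have "\<dots> \<le> (\<integral>p. 2 * cpsi * norm (gH (ev G (fst p)) - gH (ev Gs (fst p))) \<partial>rho)"
  proof (rule integral_mono[OF int(1) integrable_mult_right[OF integrable_gap(1)]])
    fix p
    let ?a = "gH (ev G (fst p))" and ?b = "gH (ev Gs (fst p))"
    \<comment> \<open>Optimality of the decoded decision for \<open>?a\<close> allows
      \<open>?a\<close> to be subtracted at no cost.\<close>
    have "q (fst p) \<bullet> ?a \<le> 0"
      using zdec_le[of psi ?a "f (fst p)"] by (simp add: q_def inner_diff_left)
    then have "q (fst p) \<bullet> ?b \<le> q (fst p) \<bullet> (?b - ?a)"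
      by (simp add: inner_diff_right)
    also have "\<dots> \<le> norm (q (fst p)) * norm (?b - ?a)"
      by (rule norm_cauchy_schwarz)
    also have "\<dots> \<le> 2 * cpsi * norm (?b - ?a)"
      by (intro mult_right_mono qb) simp
    finally show "q (fst p) \<bullet> ?b \<le> 2 * cpsi * norm (?a - ?b)"
      by (simp add: norm_minus_commute)
  qed
  finally show ?thesis by simp
qed

text \<open>A bound independent of the number of samples: it settles \<open>n = 1\<close> and bounds
  the integrand uniformly.\<close>

lemma expected_gap_le_diameter:
  assumes "norm G \<le> D" "norm Gs \<le> D"
  shows "(\<integral>p. norm (gH (ev G (fst p)) - gH (ev Gs (fst p))) \<partial>rho) \<le> 2 * beta * kappa * D"
proof (rule integral_le_const[OF integrable_gap(1)], rule AE_I2)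
  fix p assume "p \<in> space rho"
  then have x: "fst p \<in> space MX" by (auto simp: space_rho)
  have "norm (G - Gs) \<le> 2 * D"
    using norm_triangle_ineq4[of G Gs] assms by linarith
  then have "beta * (kappa * norm (G - Gs)) \<le> beta * (kappa * (2 * D))"
    using beta_pos kappa_pos by (intro mult_left_mono) auto
  moreover have "beta * norm (ev G (fst p) - ev Gs (fst p)) \<le> beta * (kappa * norm (G - Gs))"
    using norm_ev_diff_le[OF x, of G Gs] beta_pos by (intro mult_left_mono) auto
  ultimately show "norm (gH (ev G (fst p)) - gH (ev Gs (fst p))) \<le> 2 * beta * kappa * D"
    using gradient_lipschitz[of "ev G (fst p)" "ev Gs (fst p)"] by (simp add: mult_ac)
qed

text \<open>A linearised form of Jensen's inequality for the square root; being affine in the excess, it can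
  be carried through the iterated integrals.\<close>

lemma expected_gap_le_linear:
  assumes "0 < l"
  shows "(\<integral>p. norm (gH (ev G (fst p)) - gH (ev Gs (fst p))) \<partial>rho) \<le> beta * excess G / l + l / 2"
proof -
  let ?g = "\<lambda>p. norm (gH (ev G (fst p)) - gH (ev Gs (fst p)))"
  have "(\<integral>p. ?g p \<partial>rho) \<le> (\<integral>p. (1 / (2 * l)) * (?g p)\<^sup>2 + l / 2 \<partial>rho)"
  proof (rule integral_mono[OF integrable_gap(1)])
    show "integrable rho (\<lambda>p. (1 / (2 * l)) * (?g p)\<^sup>2 + l / 2)"
      using integrable_gap(2)[of G] by simp
    fix p
    have "0 \<le> (?g p - l)\<^sup>2 / (2 * l)"
      using assms by simp
    also have "\<dots> = (1 / (2 * l)) * (?g p)\<^sup>2 + l / 2 - ?g p"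
      using assms by (simp add: power2_eq_square field_simps)
    finally show "?g p \<le> (1 / (2 * l)) * (?g p)\<^sup>2 + l / 2"
      by simp
  qed
  also have "\<dots> = (1 / (2 * l)) * (\<integral>p. (?g p)\<^sup>2 \<partial>rho) + l / 2"
    using integrable_gap(2)[of G] by (simp add: prob_space)
  also have "\<dots> \<le> (1 / (2 * l)) * (2 * beta * excess G) + l / 2"
    using assms by (intro add_right_mono mult_left_mono expected_gap_le_excess) auto
  finally show ?thesis
    using assms by simp
qed

text \<open>Projection does not increase the distance to \<open>Gs\<close>; the square is then
  expanded, and the cross term becomes a pointwise inner product.\<close>

lemma sgd_step:
  assumes "x \<in> space MX" "0 < D" "norm Gs \<le> D" and w: "norm w \<le> W"
  shows "(norm (projD D (G - eta *\<^sub>R (\<chi> j. (w $ j) *\<^sub>R kx x)) - Gs))\<^sup>2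
     \<le> (norm (G - Gs))\<^sup>2 - 2 * eta * (w \<bullet> (ev G x - ev Gs x)) + eta\<^sup>2 * (kappa * W)\<^sup>2"
proof -
  let ?t = "(\<chi> j. (w $ j) *\<^sub>R kx x) :: 'g^'k"
  have expand: "(norm (a - eta *\<^sub>R t))\<^sup>2 = (norm a)\<^sup>2 - 2 * eta * (a \<bullet> t) + eta\<^sup>2 * (norm t)\<^sup>2"
    for a t :: "'g^'k"
    unfolding power2_norm_eq_inner
    by (simp add: inner_diff_left inner_diff_right inner_commute power2_eq_square)
  have "norm ?t \<le> W * kappa"
    unfolding norm_tensor using norm_kx_le[OF assms(1)] w order_trans[OF norm_ge_zero w]
    by (intro mult_mono) auto
  then have "(norm ?t)\<^sup>2 \<le> (kappa * W)\<^sup>2"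
    by (intro power_mono) (auto simp: mult.commute)
  then have t: "eta\<^sup>2 * (norm ?t)\<^sup>2 \<le> eta\<^sup>2 * (kappa * W)\<^sup>2"
    by (intro mult_left_mono) auto
  have "(norm (projD D (G - eta *\<^sub>R ?t) - Gs))\<^sup>2 \<le> (norm (G - eta *\<^sub>R ?t - Gs))\<^sup>2"
    by (intro power_mono norm_projD_diff_le assms) simp
  also have "\<dots> = (norm ((G - Gs) - eta *\<^sub>R ?t))\<^sup>2"
    by (simp add: algebra_simps)
  also have "\<dots> \<le> (norm (G - Gs))\<^sup>2 - 2 * eta * (w \<bullet> (ev G x - ev Gs x)) + eta\<^sup>2 * (kappa * W)\<^sup>2"
    unfolding expand inner_tensor_evalv evalv_diff using t by simp
  finally show ?thesis .
qed

text \<open>An affine bound in the summed excess suffices for \<open>F\<close>, because the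
  potential \<open>Psi\<close> does not increase in conditional expectation.\<close>

lemma integral_le_of_sgd:
  fixes F :: "(nat \<Rightarrow> 'x \<times> 'y) \<Rightarrow> real" and eta D :: real
  defines "it \<equiv> asgd_iter kx (\<lambda>v y. gH v - phi y) eta D"
  assumes D: "0 < D" "norm Gs \<le> D"
    and W: "\<And>v y. norm v \<le> kappa * D \<Longrightarrow> norm (gH v - phi y) \<le> W"
    and eta: "0 < eta" and a: "0 \<le> a"
    and F: "F \<in> borel_measurable (PiM {..<n} (\<lambda>_. rho))" "\<And>s. \<bar>F s\<bar> \<le> K"
      "\<And>s. F s \<le> a * (\<Sum>i=1..n. 2 * eta * excess (it s i)) + b"
  shows "(\<integral>s. F s \<partial>PiM {..<n} (\<lambda>_. rho)) \<le> a * (D\<^sup>2 + (real n + 1) * (eta * kappa * W)\<^sup>2) + b"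
proof -
  define B where "B = (eta * kappa * W)\<^sup>2"
  \<comment> \<open>The potential: excess already paid, squared distance to \<open>Gs\<close>, and a
    reserve \<open>B\<close> for each remaining step. The extra 1 funds the virtual step after the
    last iterate.\<close>
  define Psi where "Psi = (\<lambda>j s. (\<Sum>i<j. 2 * eta * excess (it s i)) + (norm (it s j - Gs))\<^sup>2
      + (real n + 1 - real j) * B)"
  have step: "(norm (projD D (G - eta *\<^sub>R (\<chi> j. ((gH (ev G (fst p)) - phi (snd p)) $ j) *\<^sub>R kx (fst p))) - Gs))\<^sup>2
      \<le> (norm (G - Gs))\<^sup>2
        - 2 * eta * ((gH (ev G (fst p)) - phi (snd p)) \<bullet> (ev G (fst p) - ev Gs (fst p))) + B"
    if "p \<in> space rho" "norm G \<le> D" for p G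
  proof -
    have x: "fst p \<in> space MX"
      using that by (auto simp: space_rho)
    have "norm (ev G (fst p)) \<le> kappa * D"
      using norm_ev_le[OF x, of G] that(2) kappa_pos mult_left_mono[of "norm G" D kappa] by linarith
    then show ?thesis
      using sgd_step[OF x D W, of "ev G (fst p)" G eta "snd p"]
      by (simp add: B_def power_mult_distrib mult.assoc)
  qed
  have itD: "norm (it s j) \<le> D" for s j
    unfolding it_def using D by (intro norm_asgd_iter_le) simp
  have drift: "integrable rho (\<lambda>p. (norm (G - Gs))\<^sup>2
        - 2 * eta * ((gH (ev G (fst p)) - phi (snd p)) \<bullet> (ev G (fst p) - ev Gs (fst p))) + B)"
    "(\<integral>p. (norm (G - Gs))\<^sup>2
        - 2 * eta * ((gH (ev G (fst p)) - phi (snd p)) \<bullet> (ev G (fst p) - ev Gs (fst p))) + B \<partial>rho)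
      \<le> (norm (G - Gs))\<^sup>2 - 2 * eta * excess G + B" for G
    using integrable_gradient[of G] excess_le_gradient[of G] eta by (simp_all add: prob_space)
  txt \<open>The average includes the last iterate, whose excess is controlled by one further, virtual step.\<close>
  have last: "2 * eta * excess G \<le> (norm (G - Gs))\<^sup>2 + B" if "norm G \<le> D" for G
  proof -
    have "0 \<le> (\<integral>p. (norm (G - Gs))\<^sup>2
        - 2 * eta * ((gH (ev G (fst p)) - phi (snd p)) \<bullet> (ev G (fst p) - ev Gs (fst p))) + B \<partial>rho)"
      by (rule Bochner_Integration.integral_nonneg)
        (rule order_trans[OF zero_le_power2 step], use that in auto)
    then show ?thesis
      using drift(2)[of G] by linarith
  qed
  have "(\<integral>s. F s \<partial>PiM {..<n} (\<lambda>_. rho)) \<le> a * Psi 0 (\<lambda>_. undefined) + b"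
  proof (rule integral_PiM_le_backward[where \<Phi> = "\<lambda>j s. a * Psi j s + b", OF F(1) F(2)])
    fix s
    \<comment> \<open>The potential also counts iterate 0, while the average starts at 1;
      nonnegativity of the excess absorbs the shift.\<close>
    have "(\<Sum>i=1..n. 2 * eta * excess (it s i)) \<le> (\<Sum>i\<le>n. 2 * eta * excess (it s i))"
      using eta excess_nonneg by (intro sum_mono2) auto
    also have "\<dots> = (\<Sum>i<n. 2 * eta * excess (it s i)) + 2 * eta * excess (it s n)"
      by (simp flip: lessThan_Suc_atMost)
    also have "\<dots> \<le> Psi n s"
      using last[OF itD, of s n] by (simp add: Psi_def)
    finally have "a * (\<Sum>i=1..n. 2 * eta * excess (it s i)) \<le> a * Psi n s"
      using a by (rule mult_left_mono)
    then show "F s \<le> a * Psi n s + b"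
      using F(3)[of s] by linarith
  next
    fix j s assume "j < n"
    define G where "G = it s j"
    \<comment> \<open>\<open>?gain\<close> bounds the next squared distance as a function of the new
      sample; \<open>?c\<close> collects what the past already determines, including the excess of
      iterate \<open>j\<close>.\<close>
    let ?gain = "\<lambda>p. (norm (G - Gs))\<^sup>2
        - 2 * eta * ((gH (ev G (fst p)) - phi (snd p)) \<bullet> (ev G (fst p) - ev Gs (fst p))) + B"
    let ?c = "(\<Sum>i\<le>j. 2 * eta * excess (it s i)) + (real n - real j) * B"
    let ?bound = "\<lambda>p. a * (?c + ?gain p) + b"
    have past: "it (s(j := p)) i = it s i" if "i \<le> j" for i p
      unfolding it_def using that by (intro asgd_iter_cong) auto
    have "integrable rho ?bound"
      using drift(1)[of G] by simp
    moreover have "a * Psi (Suc j) (s(j := p)) + b \<le> ?bound p" if "p \<in> space rho" for p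
    proof -
      have "it (s(j := p)) (Suc j)
          = projD D (G - eta *\<^sub>R (\<chi> l. ((gH (ev G (fst p)) - phi (snd p)) $ l) *\<^sub>R kx (fst p)))"
        using past[of j p] unfolding it_def G_def by (simp add: Let_def)
      then have "(norm (it (s(j := p)) (Suc j) - Gs))\<^sup>2 \<le> ?gain p"
        using step[OF that, of G] itD[of s j] by (simp add: G_def)
      moreover have "(\<Sum>i<Suc j. 2 * eta * excess (it (s(j := p)) i)) = (\<Sum>i\<le>j. 2 * eta * excess (it s i))"
        unfolding lessThan_Suc_atMost by (intro sum.cong) (auto simp: past)
      ultimately have "Psi (Suc j) (s(j := p)) \<le> ?c + ?gain p"
        by (simp add: Psi_def)
      then show ?thesis
        using a by (simp add: mult_left_mono)
    qed
    moreover have "(\<integral>p. ?bound p \<partial>rho) \<le> a * Psi j s + b"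
    proof -
      have "(\<integral>p. ?bound p \<partial>rho) = a * (?c + (\<integral>p. ?gain p \<partial>rho)) + b"
        using drift(1)[of G] by (simp add: prob_space del: Bochner_Integration.integral_diff)
      \<comment> \<open>The excess of iterate \<open>j\<close> inside \<open>?c\<close> cancels
        against the drift of \<open>?gain\<close>.\<close>
      also have "?c + (\<integral>p. ?gain p \<partial>rho) \<le> Psi j s"
        using drift(2)[of G]
        by (simp add: Psi_def G_def lessThan_Suc_atMost[symmetric] algebra_simps)
      finally show ?thesis
        using a by (simp add: mult_left_mono)
    qed
    ultimately show "\<exists>\<xi>. integrable rho \<xi> \<and> (\<forall>x\<in>space rho. a * Psi (Suc j) (s(j := x)) + b \<le> \<xi> x)
        \<and> (\<integral>p. \<xi> p \<partial>rho) \<le> a * Psi j s + b"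
      by (intro exI[of _ ?bound]) auto
  qed
  also have "Psi 0 (\<lambda>_. undefined) = (norm Gs)\<^sup>2 + (real n + 1) * B"
    by (simp add: Psi_def it_def)
  also have "a * ((norm Gs)\<^sup>2 + (real n + 1) * B) + b \<le> a * (D\<^sup>2 + (real n + 1) * B) + b"
    using a D by (intro add_right_mono mult_left_mono power_mono) auto
  finally show ?thesis
    by (simp add: B_def)
qed

end

section \<open>Assembling the rate: gradient bound, step size and balancing of the two error
  terms\<close>

theorem theorem4p6:
  fixes MX :: "'x measure"
    and rho :: "('x \<times> 'y::finite) measure"
    and psi :: "'z::{finite,linorder} \<Rightarrow> real^'k::finite"
    and phi :: "'y \<Rightarrow> real^'k"
    and c :: real
    and Dom :: "(real^'k) set"
    and h :: "real^'k \<Rightarrow> real"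
    and beta :: real
    and kx :: "'x \<Rightarrow> 'g::{real_inner,complete_space}"
    and kappa D :: real
    and fstar :: "'x \<Rightarrow> 'z"
    and gstar :: "'x \<Rightarrow> real^'k"
    and n :: nat
    and C eta :: real
  assumes legendre: "legendre_type Dom h"
    and hull_sub: "convex hull (range phi) \<subseteq> Dom"
    and conj_finite: "\<forall>v. bdd_above ((\<lambda>u. v \<bullet> u - h u) ` Dom)"
    and conj_diff: "\<forall>v. fconj Dom h differentiable (at v)"
    and beta_pos: "beta > 0"
    and strongly: "strongly_convex_on (1 / beta) Dom h"
    and prob: "prob_space rho"
    and sets_rho: "sets rho = sets (MX \<Otimes>\<^sub>M count_space UNIV)"
    and kx_meas: "kx \<in> borel_measurable MX"
    and kx_rkhs: "\<forall>G. (\<forall>x\<in>space MX. kx x \<bullet> G = 0) \<longrightarrow> G = 0"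
    and kappa_pos: "kappa > 0"
    and kx_bound: "\<forall>x\<in>space MX. kx x \<bullet> kx x \<le> kappa\<^sup>2"
    and D_pos: "D > 0"
    and fstar_meas: "fstar \<in> MX \<rightarrow>\<^sub>M count_space UNIV"
    and fstar_min: "\<forall>f \<in> MX \<rightarrow>\<^sub>M count_space UNIV. Erisk rho psi phi c fstar \<le> Erisk rho psi phi c f"
    and gstar_meas: "gstar \<in> borel_measurable MX"
    and gstar_min: "\<forall>g \<in> borel_measurable MX. Rrisk rho Dom h phi gstar \<le> Rrisk rho Dom h phi g"
    and gstar_in_G: "\<exists>G::'g^'k. norm G \<le> D \<and> (\<forall>x\<in>space MX. gstar x = evalv kx G x)"
    and n_pos: "n > 0"
    and C_def: "C = sqrt (1 + Max (range (\<lambda>y. norm (phi y - grad (fconj Dom h) 0))) / (kappa * beta * D))"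
    and eta_def: "eta = 2 / (beta * kappa\<^sup>2 * C\<^sup>2 * sqrt (real n))"
  shows "(\<integral>s. Erisk rho psi phi c
                 (\<lambda>x. decode psi Dom h
                        (evalv kx (asgd_avg kx (\<lambda>v y. grad (\<lambda>w. Sloss Dom h phi w y) v) eta D s n) x))
               - Erisk rho psi phi c fstar
             \<partial>(PiM {..<n} (\<lambda>_. rho)))
         \<le> 4 * kappa * Max (range (\<lambda>z. norm (psi z))) * beta * D * C / real n powr (1/4)"
proof -
  let ?H = "fconj Dom h"
  let ?gH = "grad ?H"
  let ?M = "Max (range (\<lambda>y. norm (phi y - ?gH 0)))"
  define cpsi where "cpsi = Max (range (\<lambda>z. norm (psi z)))"
  \<comment> \<open>This also supplies a point of \<open>Dom\<close>, so the suprema defining the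
    conjugate are over a nonempty set.\<close>
  have phi_Dom: "phi y \<in> Dom" for y
    using hull_sub hull_subset[of "range phi" convex] by blast
  interpret smooth_convex ?H ?gH beta
    using legendre phi_Dom conj_finite conj_diff strongly beta_pos
    by (intro smooth_convex_fconj) (auto simp: legendre_type_def)
  interpret rkhs_sample ?H ?gH beta rho MX kx kappa phi
    using kx_bound
    by (intro rkhs_sample.intro rkhs_sample_axioms.intro smooth_convex_axioms prob sets_rho kx_meas kappa_pos) auto
  obtain Gs :: "'g^'k" where Gs: "norm Gs \<le> D" "\<And>x. x \<in> space MX \<Longrightarrow> gstar x = ev Gs x"
    using gstar_in_G by blast
  have risk: "Rrisk rho Dom h phi g
      = (\<integral>\<^sup>+p. ennreal (?H (g (fst p)) + h (phi (snd p)) - phi (snd p) \<bullet> g (fst p)) \<partial>rho)" for g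
    by (simp add: Rrisk_def Sloss_def)
  have "Rrisk rho Dom h phi gstar = Rrisk rho Dom h phi (ev Gs)"
    unfolding risk by (rule nn_integral_cong) (auto simp: space_rho Gs(2))
  then have Gs_min: "Rrisk rho Dom h phi (ev Gs) \<le> Rrisk rho Dom h phi g" if "g \<in> borel_measurable MX" for g
    using gstar_min that by metis
  interpret rkhs_minimizer ?H ?gH beta rho MX kx kappa phi Gs
  proof
    fix q :: "'x \<Rightarrow> real^'k" and B
    assume q: "q \<in> borel_measurable MX" "\<And>x. x \<in> space MX \<Longrightarrow> norm (q x) \<le> B"
    show "(\<integral>p. q (fst p) \<bullet> (?gH (ev Gs (fst p)) - phi (snd p)) \<partial>rho) = 0"
    proof (rule stationary[where a = "\<lambda>y. h (phi y)", OF _ Gs_min[unfolded risk] q])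
      show "0 \<le> ?H v + h (phi y) - phi y \<bullet> v" for v y
        using fconj_ge[OF conj_finite[rule_format] phi_Dom, of v y] inner_commute[of v "phi y"] by linarith
    qed
  qed
  have gradS: "grad (\<lambda>w. Sloss Dom h phi w y) v = ?gH v - phi y" for v y
  proof (rule grad_eqI)
    have "GDERIV (\<lambda>w. ?H w + h (phi y) - phi y \<bullet> w) v :> ?gH v + 0 - phi y"
      by (intro GDERIV_diff GDERIV_add GDERIV_const GDERIV_grad conj_diff[rule_format])
        (auto simp: gderiv_def inner_commute intro!: derivative_eq_intros)
    then show "GDERIV (\<lambda>w. Sloss Dom h phi w y) v :> ?gH v - phi y"
      by (simp add: Sloss_def)
  qed
  define avg where "avg = (\<lambda>s. asgd_avg kx (\<lambda>v y. ?gH v - phi y) eta D s n)"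
  define F where "F = (\<lambda>s. Erisk rho psi phi c (\<lambda>x. zdec psi (?gH (ev (avg s) x))) - Erisk rho psi phi c fstar)"
  have cpsi: "norm (psi z) \<le> cpsi" for z
    unfolding cpsi_def by (rule Max_ge) auto
  then have cpsi_nonneg: "0 \<le> cpsi"
    using norm_ge_zero order_trans by blast
  have M: "norm (phi y - ?gH 0) \<le> ?M" for y
    by (rule Max_ge) auto
  then have M_nonneg: "0 \<le> ?M"
    using norm_ge_zero order_trans by blast
  have kbD: "0 < kappa * beta * D"
    using kappa_pos beta_pos D_pos by simp
  have C2: "C\<^sup>2 = 1 + ?M / (kappa * beta * D)"
    unfolding C_def using kbD M_nonneg by (intro real_sqrt_pow2) auto
  have C_ge1: "1 \<le> C"
    unfolding C_def using kbD M_nonneg by simp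
  then have C_pos: "0 < C" by simp
  \<comment> \<open>\<open>W\<close> bounds the stochastic gradients wherever
    \<open>norm v \<le> kappa * D\<close>; \<open>C^2\<close> is exactly the factor relating it to
    \<open>kappa * beta * D\<close>.\<close>
  define W where "W = kappa * beta * D * C\<^sup>2"
  have W_eq: "W = kappa * beta * D + ?M"
    unfolding W_def C2 distrib_left using kappa_pos beta_pos D_pos by simp
  have W: "norm (?gH v - phi y) \<le> W" if "norm v \<le> kappa * D" for v y
  proof -
    have "norm (?gH v - phi y) \<le> norm (?gH v - ?gH 0) + norm (phi y - ?gH 0)"
      using norm_triangle_ineq4[of "?gH v - ?gH 0" "phi y - ?gH 0"] by simp
    also have "\<dots> \<le> beta * (kappa * D) + ?M"
    proof (rule add_mono[OF _ M])
      have "norm (?gH v - ?gH 0) \<le> beta * norm v"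
        using gradient_lipschitz[of v 0] by simp
      also have "\<dots> \<le> beta * (kappa * D)"
        using that beta_pos by (intro mult_left_mono) auto
      finally show "norm (?gH v - ?gH 0) \<le> beta * (kappa * D)" .
    qed
    finally show ?thesis
      by (simp add: W_eq mult_ac)
  qed
  have avgD: "norm (avg s) \<le> D" for s
    unfolding avg_def using D_pos n_pos by (intro norm_asgd_avg_le) auto
  have F_le: "F s \<le> 2 * cpsi * (\<integral>p. norm (?gH (ev (avg s) (fst p)) - ?gH (ev Gs (fst p))) \<partial>rho)" for s
    unfolding F_def by (rule Erisk_diff_le[OF fstar_meas cpsi])
  have F_bound: "F s \<le> 4 * kappa * cpsi * beta * D" for s
    using F_le[of s] mult_left_mono[OF expected_gap_le_diameter[OF avgD Gs(1)], of "2 * cpsi" s] cpsi_nonneg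
    by (simp add: mult_ac)
  have "(\<lambda>x. zdec psi (?gH (ev G x))) \<in> MX \<rightarrow>\<^sub>M count_space UNIV" for G
    by (rule measurable_compose[OF _ measurable_zdec]) measurable
  then have F_nonneg: "0 \<le> F s" for s
    unfolding F_def using fstar_min by simp
  define r where "r = real n powr (1/4)"
  have r: "0 < r"
    using n_pos by (simp add: r_def)
  have r4: "r ^ 4 = real n"
    using n_pos by (simp add: r_def powr_realpow[symmetric] powr_powr)
  have r2: "sqrt (real n) = r\<^sup>2"
    unfolding r4[symmetric] by (rule real_sqrt_unique) (simp_all flip: power_mult)
  \<comment> \<open>The Jensen parameter is chosen so that the optimisation error and the term
    \<open>l / 2\<close> each contribute \<open>cpsi * l\<close>, and \<open>2 * cpsi * l\<close> is
    the claimed bound.\<close>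
  define l where "l = 2 * beta * kappa * C * D / r"
  have l: "0 < l"
    using beta_pos kappa_pos C_pos D_pos r by (simp add: l_def)
  have "(\<integral>s. F s \<partial>PiM {..<n} (\<lambda>_. rho)) \<le> 2 * cpsi * l"
  proof (cases "integrable (PiM {..<n} (\<lambda>_. rho)) F")
    case False
    txt \<open>Without separability of the RKHS, \<open>F\<close> may fail to be measurable; its integral is then \<open>0\<close>.\<close>
    then show ?thesis
      using cpsi_nonneg l by (simp add: not_integrable_integral_eq)
  next
    case True
    interpret P: prob_space "PiM {..<n} (\<lambda>_. rho)"
      by (rule prob_space_PiM) (rule prob)
    show ?thesis
    \<comment> \<open>The potential argument yields the factor \<open>1 + 4 + 4 / n\<close> on
      \<open>D^2\<close>, against 8 available: it is 9 at \<open>n = 1\<close> and at most 7 from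
      \<open>n = 2\<close> on. At \<open>n = 1\<close> the diameter bound and
      \<open>C \<ge> 1\<close> suffice.\<close>
    proof (cases "n = 1")
      case n1: True
      have "(\<integral>s. F s \<partial>PiM {..<n} (\<lambda>_. rho)) \<le> 4 * kappa * cpsi * beta * D"
        using True F_bound by (intro P.integral_le_const) auto
      also have "\<dots> \<le> 4 * kappa * cpsi * beta * D * C"
        using mult_left_mono[OF C_ge1, of "4 * kappa * cpsi * beta * D"] kappa_pos cpsi_nonneg beta_pos D_pos
        by simp
      also have "\<dots> = 2 * cpsi * l"
        using n1 by (simp add: l_def r_def)
      finally show ?thesis .
    next
      case False
      then have n2: "2 \<le> real n" using n_pos by linarith
      have eta: "eta = 2 / (beta * kappa\<^sup>2 * C\<^sup>2 * r\<^sup>2)"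
        unfolding eta_def r2 ..
      have eta_pos: "0 < eta"
        unfolding eta using beta_pos kappa_pos C_pos r by simp
      \<comment> \<open>This weight turns \<open>2 * cpsi * beta / l\<close> times the average
        excess into a multiple of the sum weighted by \<open>2 * eta\<close>.\<close>
      define a where "a = cpsi * beta / (l * real n * eta)"
      have a: "0 \<le> a"
        using cpsi_nonneg beta_pos l eta_pos by (simp add: a_def)
      have "(\<integral>s. F s \<partial>PiM {..<n} (\<lambda>_. rho)) \<le> a * (D\<^sup>2 + (real n + 1) * (eta * kappa * W)\<^sup>2) + cpsi * l"
      proof (rule integral_le_of_sgd[OF D_pos Gs(1) W eta_pos a borel_measurable_integrable[OF True]])
        show "\<bar>F s\<bar> \<le> 4 * kappa * cpsi * beta * D" for s
          using F_bound F_nonneg by simp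
        fix s
        let ?it = "asgd_iter kx (\<lambda>v y. ?gH v - phi y) eta D s"
        let ?S = "\<Sum>i=1..n. excess (?it i)"
        have "excess (avg s) \<le> (1 / real n) * ?S"
          unfolding avg_def asgd_avg_def by (rule excess_average[OF n_pos])
        then have "beta * excess (avg s) / l + l / 2 \<le> beta * ((1 / real n) * ?S) / l + l / 2"
          using beta_pos l by (intro add_right_mono divide_right_mono mult_left_mono) auto
        then have "F s \<le> 2 * cpsi * (beta * ((1 / real n) * ?S) / l + l / 2)"
          using F_le[of s] expected_gap_le_linear[OF l, of "avg s"] cpsi_nonneg
          by (meson mult_left_mono mult_nonneg_nonneg order_trans zero_le_numeral)
        also have "\<dots> = a * (2 * eta * ?S) + cpsi * l"
          using l eta_pos n_pos by (simp add: a_def field_simps)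
        also have "2 * eta * ?S = (\<Sum>i=1..n. 2 * eta * excess (?it i))"
          by (rule sum_distrib_left)
        finally show "F s \<le> a * (\<Sum>i=1..n. 2 * eta * excess (?it i)) + cpsi * l" .
      qed
      also have "a * (D\<^sup>2 + (real n + 1) * (eta * kappa * W)\<^sup>2) \<le> a * (8 * D\<^sup>2)"
      proof (rule mult_left_mono[OF _ a])
        \<comment> \<open>The step size cancels \<open>C^2\<close> in \<open>W\<close>, so every
          step costs \<open>4 * D^2 / n\<close>.\<close>
        have "eta * kappa * W = 2 * D / r\<^sup>2"
          unfolding eta W_def using beta_pos kappa_pos C_pos r by (simp add: field_simps power2_eq_square)
        then have "(eta * kappa * W)\<^sup>2 = 4 * D\<^sup>2 / real n"
          by (simp add: power_divide power_mult_distrib r4[symmetric] flip: power_mult)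
        moreover have "(real n + 1) * (4 * D\<^sup>2 / real n) = (4 + 4 / real n) * D\<^sup>2"
          using n2 by (simp add: field_simps)
        moreover have "(4 + 4 / real n) * D\<^sup>2 \<le> 7 * D\<^sup>2"
          using n2 by (intro mult_right_mono) (auto simp: field_simps)
        ultimately show "D\<^sup>2 + (real n + 1) * (eta * kappa * W)\<^sup>2 \<le> 8 * D\<^sup>2"
          by simp
      qed
      also have "a * (8 * D\<^sup>2) = cpsi * l"
        unfolding a_def eta l_def r4[symmetric] using beta_pos kappa_pos C_pos D_pos r
        by (simp add: field_simps power2_eq_square power4_eq_xxxx)
      finally show ?thesis by simp
    qed
  qed
  also have "2 * cpsi * l = 4 * kappa * cpsi * beta * D * C / real n powr (1/4)"
    by (simp add: l_def r_def)
  finally show ?thesis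
    by (simp add: F_def avg_def decode_def gradS cpsi_def)
qed

end
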